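(* Let $A\in\mathbb{R}^{n\times n}$, let $Q\in\mathbb{R}^{n\times n}$ be symmetric, and suppose that the discrete-time Lyapunov equation $AXA'-X+Q=0_{n\times n}$ has at least one solution $X\in\mathbb{R}^{n\times n}$. Let $\mathcal{G}_k$ $(k\ge 0)$ be undirected simple graphs on the node set $\{1,\dots,m\}$ with symmetric doubly stochastic adjacency matrices $\mathcal{A}_k=[a_{ij,k}]$. Suppose the following. (a) For each $i$, $0<\alpha_i<\min\{1,1/\xi_i\}$, where $\xi_i$ is a real number such that $$\|-A_{ri}'T_1-T_2E_{li}'\|_F^2+\|E_{li}T_1+T_2A_{ri}\|_F^2\le \xi_i\|T_1\|_F^2+\xi_i\|T_2\|_F^2\quad\text{for all } T_1\in\mathbb{R}^{n_i\times n},\ T_2\in\mathbb{R}^{n\times n_i}.$$ (b) The graph sequence $\{\mathcal{G}_k\}$ is uniformly connected: there is an integer $B\ge1$ such that for every $k\ge0$ the union of the edge sets of $\mathcal{G}_k,\dots,\mathcal{G}_{k+B-1}$ forms a connected graph on $\{1,\dots,m\}$. (c) There is a scalar $\eta$ with $0<\eta<1$ such that for all $k\ge0$ and all $i$: $w_{ii,k}\ge\eta$; for $j\ne i$, $w_{ij,k}\ge\eta$ if $j\in\mathcal{N}_{i,k}$, and $w_{ij,k}=0$ otherwise. Let $\{\hat Z_k\}_{k\ge0}$ be generated, from an arbitrary initial value $\hat Z_0$, by the distributed algorithm given in the context. Then: (i) The states of all agents converge to one same solution: there is an optimal solution $\hat Z^*$ of the optimization problem given in the context (so all the blocks $Z_i^*$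 of $\hat Z^*$ are equal) such that $\hat Z_k\to\hat Z^*$ as $k\to\infty$. (ii) $\sum_{i=1}^m(1-\alpha_i\xi_i)f_i(\bar Z_{i,k})=O(1/k)$ as $k\to\infty$, where $\bar Z_{i,k}=\frac1k\sum_{l=1}^kZ_{i,l}$.
   Context: $A'$ denotes the transpose of $A$, $\|\cdot\|_F$ the Frobenius norm, $E_n$ the $n\times n$ identity matrix. Decomposition. There are $m$ agents and positive integers $n_1,\dots,n_m$ with $\sum_i n_i=n$. The matrix $A$ is partitioned into row blocks $A_{ri}\in\mathbb{R}^{n_i\times n}$ ($A$ is $A_{r1},\dots,A_{rm}$ stacked vertically). The matrices $Q=[Q_{l1},\dots,Q_{lm}]$ and $E_n=[E_{l1},\dots,E_{lm}]$ are partitioned into column blocks $Q_{li},E_{li}\in\mathbb{R}^{n\times n_i}$. For $Y_i\in\mathbb{R}^{n\times n}$, $Y_i^{ri}\in\mathbb{R}^{n_i\times n}$ denotes the $i$-th row block of $Y_i$ in the same row partition. Optimization problem. For $X_i,Y_i\in\mathbb{R}^{n\times n}$ set $Z_i=\begin{bmatrix}Y_i\\ X_i\end{bmatrix}\in\mathbb{R}^{2n\times n}$ and $$f_i(Z_i)=f_i(X_i,Y_i)=\tfrac12\|Y_i^{ri}-A_{ri}X_i\|_F^2+\tfrac12\|Y_iA_{ri}'-X_iE_{li}+Q_{li}\|_F^2 .$$ Let $\hat Z\in\mathbb{R}^{2mn\times n}$ be $Z_1,\dots,Z_m$ stacked vertically. The problem is: minimize $\sum_{i=1}^m f_i(X_i,Y_i)$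 subject to $X_i=X_j$, $Y_i=Y_j$ for all $i,j\in\{1,\dots,m\}$. An optimal solution is written as the corresponding stacked matrix $\hat Z^*$. Graphs. $\mathcal{G}_k$ is the communication graph at time $k$; $a_{ij,k}=a_{ji,k}\ge0$, $a_{ii,k}=0$, and $a_{ij,k}>0$ exactly when $(i,j)$ is an edge of $\mathcal{G}_k$; $\mathcal{N}_{i,k}$ is the set of neighbors of $i$ in $\mathcal{G}_k$. The Laplacian $\mathcal{L}_k=[l_{ij,k}]$ has $l_{ij,k}=-a_{ij,k}$ for $i\ne j$ and $l_{ii,k}=\sum_{j\in\mathcal{N}_{i,k}}a_{ij,k}$. Put $w_{ii,k}=1-\frac{\alpha_i}{2}l_{ii,k}$ and $w_{ij,k}=-\frac{\alpha_i}{2}l_{ij,k}$ for $i\neq j$. Algorithm (constant step sizes $\alpha_1,\dots,\alpha_m$). For $k\ge0$ and each $i$, $$X_{i,k+1}=X_{i,k}-\alpha_i d_{X_{i,k}}-\tfrac{\alpha_i}{2}\sum_{j\in\mathcal{N}_{i,k}}a_{ij,k}(X_{i,k}-X_{j,k}),$$ $$Y_{i,k+1}=Y_{i,k}-\alpha_i d_{Y_{i,k}}-\tfrac{\alpha_i}{2}\sum_{j\in\mathcal{N}_{i,k}}a_{ij,k}(Y_{i,k}-Y_{j,k}),$$ where $$d_{X_{i,k}}=-A_{ri}'(Y_{i,k}^{ri}-A_{ri}X_{i,k})-(Y_{i,k}A_{ri}'-X_{i,k}E_{li}+Q_{li})E_{li}',$$ $$d_{Y_{i,k}}=E_{li}(Y_{i,k}^{ri}-A_{ri}X_{i,k})+(Y_{i,k}A_{ri}'-X_{i,k}E_{li}+Q_{li})A_{ri}$$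 are the partial gradients of $f_i$ at $(X_{i,k},Y_{i,k})$. Write $Z_{i,k}=\begin{bmatrix}Y_{i,k}\\ X_{i,k}\end{bmatrix}$ and let $\hat Z_k$ be $Z_{1,k},\dots,Z_{m,k}$ stacked vertically. Equivalently, $Z_{i,k+1}=\sum_{j=1}^m w_{ij,k}Z_{j,k}-\alpha_i\nabla f_i(Z_{i,k})$. *)

theory Defs
  imports
    "Jordan_Normal_Form.Matrix"
    "Graph_Theory.Pair_Digraph"
    "Graph_Theory.Digraph_Component"
    "HOL-Library.Landau_Symbols"
begin

text \<open>Agents and matrix indices are numbered from 0, so the agents are \<open>0, \<dots>, m - 1\<close>.\<close>

definition frob_norm :: "real mat \<Rightarrow> real" where
  "frob_norm M = sqrt (\<Sum>r<dim_row M. \<Sum>c<dim_col M. (M $$ (r, c))\<^sup>2)"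

text \<open>The library's matrices have no fixed dimension and hence no generic zero, so finite sums of
  \<open>nr \<times> nc\<close> matrices are defined entrywise.\<close>

definition mat_sum :: "nat \<Rightarrow> nat \<Rightarrow> ('i \<Rightarrow> real mat) \<Rightarrow> 'i set \<Rightarrow> real mat" where
  "mat_sum nr nc M I = mat nr nc (\<lambda>(r, c). \<Sum>i\<in>I. M i $$ (r, c))"

text \<open>Blocks with respect to the partition of \<open>{0..<n}\<close> into consecutive intervals of lengths
  \<open>ns 0, ns 1, \<dots>\<close>.\<close>

definition block_offset :: "(nat \<Rightarrow> nat) \<Rightarrow> nat \<Rightarrow> nat" where
  "block_offset ns i = (\<Sum>j<i. ns j)"

definition row_block :: "(nat \<Rightarrow> nat) \<Rightarrow> nat \<Rightarrow> real mat \<Rightarrow> real mat" where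
  "row_block ns i M = mat (ns i) (dim_col M) (\<lambda>(r, c). M $$ (block_offset ns i + r, c))"

definition col_block :: "(nat \<Rightarrow> nat) \<Rightarrow> nat \<Rightarrow> real mat \<Rightarrow> real mat" where
  "col_block ns i M = mat (dim_row M) (ns i) (\<lambda>(r, c). M $$ (r, block_offset ns i + c))"

text \<open>Vertical stack of \<open>p \<times> q\<close> matrices \<open>M 0, \<dots>, M (m - 1)\<close>, and the \<open>i\<close>-th block of height
  \<open>p\<close>.\<close>

definition vstack :: "nat \<Rightarrow> nat \<Rightarrow> nat \<Rightarrow> (nat \<Rightarrow> real mat) \<Rightarrow> real mat" where
  "vstack m p q M = mat (m * p) q (\<lambda>(r, c). M (r div p) $$ (r mod p, c))"

definition vblock :: "nat \<Rightarrow> nat \<Rightarrow> real mat \<Rightarrow> real mat" where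
  "vblock p i M = mat p (dim_col M) (\<lambda>(r, c). M $$ (i * p + r, c))"

definition E_col :: "nat \<Rightarrow> (nat \<Rightarrow> nat) \<Rightarrow> nat \<Rightarrow> real mat" where
  "E_col n ns i = col_block ns i (1\<^sub>m n)"

definition row_residual ::
  "(nat \<Rightarrow> nat) \<Rightarrow> real mat \<Rightarrow> nat \<Rightarrow> real mat \<Rightarrow> real mat \<Rightarrow> real mat" where
  "row_residual ns A i X Y = row_block ns i Y - row_block ns i A * X"

definition col_residual ::
  "nat \<Rightarrow> (nat \<Rightarrow> nat) \<Rightarrow> real mat \<Rightarrow> real mat \<Rightarrow> nat \<Rightarrow> real mat \<Rightarrow> real mat \<Rightarrow> real mat" where
  "col_residual n ns A Q i X Y =
     Y * (row_block ns i A)\<^sup>T - X * E_col n ns i + col_block ns i Q"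

definition local_cost ::
  "nat \<Rightarrow> (nat \<Rightarrow> nat) \<Rightarrow> real mat \<Rightarrow> real mat \<Rightarrow> nat \<Rightarrow> real mat \<Rightarrow> real mat \<Rightarrow> real" where
  "local_cost n ns A Q i X Y =
     1/2 * (frob_norm (row_residual ns A i X Y))\<^sup>2
     + 1/2 * (frob_norm (col_residual n ns A Q i X Y))\<^sup>2"

text \<open>A matrix \<open>Z\<close> of dimension \<open>2n \<times> n\<close> consists of \<open>Y\<close> on top of \<open>X\<close>.\<close>

definition Y_part :: "nat \<Rightarrow> real mat \<Rightarrow> real mat" where
  "Y_part n Z = vblock n 0 Z"

definition X_part :: "nat \<Rightarrow> real mat \<Rightarrow> real mat" where
  "X_part n Z = vblock n 1 Z"

definition local_cost_Z ::
  "nat \<Rightarrow> (nat \<Rightarrow> nat) \<Rightarrow> real mat \<Rightarrow> real mat \<Rightarrow> nat \<Rightarrow> real mat \<Rightarrow> real" where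
  "local_cost_Z n ns A Q i Z = local_cost n ns A Q i (X_part n Z) (Y_part n Z)"

definition total_cost ::
  "nat \<Rightarrow> nat \<Rightarrow> (nat \<Rightarrow> nat) \<Rightarrow> real mat \<Rightarrow> real mat \<Rightarrow> real mat \<Rightarrow> real" where
  "total_cost m n ns A Q Zhat = (\<Sum>i<m. local_cost_Z n ns A Q i (vblock (2 * n) i Zhat))"

definition feasible :: "nat \<Rightarrow> nat \<Rightarrow> real mat \<Rightarrow> bool" where
  "feasible m n Zhat \<longleftrightarrow>
     Zhat \<in> carrier_mat (m * (2 * n)) n \<and>
     (\<forall>i<m. \<forall>j<m.
        X_part n (vblock (2 * n) i Zhat) = X_part n (vblock (2 * n) j Zhat) \<and>
        Y_part n (vblock (2 * n) i Zhat) = Y_part n (vblock (2 * n) j Zhat))"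

definition optimal_solution ::
  "nat \<Rightarrow> nat \<Rightarrow> (nat \<Rightarrow> nat) \<Rightarrow> real mat \<Rightarrow> real mat \<Rightarrow> real mat \<Rightarrow> bool" where
  "optimal_solution m n ns A Q Zhat \<longleftrightarrow>
     feasible m n Zhat \<and>
     (\<forall>Zhat'. feasible m n Zhat' \<longrightarrow> total_cost m n ns A Q Zhat \<le> total_cost m n ns A Q Zhat')"

definition nbrs :: "nat pair_pre_digraph \<Rightarrow> nat \<Rightarrow> nat set" where
  "nbrs G i = {j. (i, j) \<in> parcs G}"

definition adjacency_matrix :: "nat \<Rightarrow> nat pair_pre_digraph \<Rightarrow> real mat \<Rightarrow> bool" where
  "adjacency_matrix m G a \<longleftrightarrow>
     a \<in> carrier_mat m m \<and> a\<^sup>T = a \<and>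
     (\<forall>i<m. a $$ (i, i) = 0) \<and>
     (\<forall>i<m. \<forall>j<m. 0 \<le> a $$ (i, j) \<and> (0 < a $$ (i, j) \<longleftrightarrow> (i, j) \<in> parcs G))"

definition doubly_stochastic :: "nat \<Rightarrow> real mat \<Rightarrow> bool" where
  "doubly_stochastic m a \<longleftrightarrow>
     a \<in> carrier_mat m m \<and>
     (\<forall>i<m. \<forall>j<m. 0 \<le> a $$ (i, j)) \<and>
     (\<forall>i<m. (\<Sum>j<m. a $$ (i, j)) = 1) \<and>
     (\<forall>j<m. (\<Sum>i<m. a $$ (i, j)) = 1)"

definition laplacian :: "nat \<Rightarrow> nat pair_pre_digraph \<Rightarrow> real mat \<Rightarrow> real mat" where
  "laplacian m G a =
     mat m m (\<lambda>(i, j). if i = j then \<Sum>h\<in>nbrs G i. a $$ (i, h) else - a $$ (i, j))"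

definition mixing_weight ::
  "nat \<Rightarrow> nat pair_pre_digraph \<Rightarrow> real mat \<Rightarrow> (nat \<Rightarrow> real) \<Rightarrow> nat \<Rightarrow> nat \<Rightarrow> real" where
  "mixing_weight m G a \<alpha> i j =
     (if i = j then 1 - \<alpha> i / 2 * laplacian m G a $$ (i, i)
      else - (\<alpha> i / 2) * laplacian m G a $$ (i, j))"

text \<open>The name \<open>connected\<close> is qualified because it is also the topological notion.\<close>

definition uniformly_connected :: "nat \<Rightarrow> (nat \<Rightarrow> nat pair_pre_digraph) \<Rightarrow> bool" where
  "uniformly_connected m G \<longleftrightarrow>
     (\<exists>B\<ge>1. \<forall>k. Digraph_Component.connected
        (with_proj \<lparr>pverts = {..<m}, parcs = (\<Union>t\<in>{k..<k + B}. parcs (G t))\<rparr>))"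

definition d_X ::
  "nat \<Rightarrow> (nat \<Rightarrow> nat) \<Rightarrow> real mat \<Rightarrow> real mat \<Rightarrow> nat \<Rightarrow> real mat \<Rightarrow> real mat \<Rightarrow> real mat" where
  "d_X n ns A Q i X Y =
     - ((row_block ns i A)\<^sup>T * row_residual ns A i X Y)
     - col_residual n ns A Q i X Y * (E_col n ns i)\<^sup>T"

definition d_Y ::
  "nat \<Rightarrow> (nat \<Rightarrow> nat) \<Rightarrow> real mat \<Rightarrow> real mat \<Rightarrow> nat \<Rightarrow> real mat \<Rightarrow> real mat \<Rightarrow> real mat" where
  "d_Y n ns A Q i X Y =
     E_col n ns i * row_residual ns A i X Y
     + col_residual n ns A Q i X Y * row_block ns i A"

definition consensus_term ::
  "nat \<Rightarrow> nat pair_pre_digraph \<Rightarrow> real mat \<Rightarrow> (nat \<Rightarrow> real mat) \<Rightarrow> nat \<Rightarrow> real mat" where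
  "consensus_term n G a M i = mat_sum n n (\<lambda>j. a $$ (i, j) \<cdot>\<^sub>m (M i - M j)) (nbrs G i)"

text \<open>\<open>X i k\<close> and \<open>Y i k\<close> are the iterates of agent \<open>i\<close> at time \<open>k\<close>; the initial values are
  arbitrary.\<close>

definition generated_by_algorithm ::
  "nat \<Rightarrow> nat \<Rightarrow> (nat \<Rightarrow> nat) \<Rightarrow> real mat \<Rightarrow> real mat \<Rightarrow> (nat \<Rightarrow> nat pair_pre_digraph) \<Rightarrow>
   (nat \<Rightarrow> real mat) \<Rightarrow> (nat \<Rightarrow> real) \<Rightarrow> (nat \<Rightarrow> nat \<Rightarrow> real mat) \<Rightarrow> (nat \<Rightarrow> nat \<Rightarrow> real mat) \<Rightarrow> bool"
  where
  "generated_by_algorithm m n ns A Q G a \<alpha> X Y \<longleftrightarrow>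
     (\<forall>i<m. X i 0 \<in> carrier_mat n n \<and> Y i 0 \<in> carrier_mat n n) \<and>
     (\<forall>k. \<forall>i<m.
        X i (Suc k) = X i k - \<alpha> i \<cdot>\<^sub>m d_X n ns A Q i (X i k) (Y i k)
          - (\<alpha> i / 2) \<cdot>\<^sub>m consensus_term n (G k) (a k) (\<lambda>j. X j k) i \<and>
        Y i (Suc k) = Y i k - \<alpha> i \<cdot>\<^sub>m d_Y n ns A Q i (X i k) (Y i k)
          - (\<alpha> i / 2) \<cdot>\<^sub>m consensus_term n (G k) (a k) (\<lambda>j. Y j k) i)"

definition agent_state ::
  "(nat \<Rightarrow> nat \<Rightarrow> real mat) \<Rightarrow> (nat \<Rightarrow> nat \<Rightarrow> real mat) \<Rightarrow> nat \<Rightarrow> nat \<Rightarrow> real mat" where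
  "agent_state X Y i k = Y i k @\<^sub>r X i k"

definition stacked_state ::
  "nat \<Rightarrow> nat \<Rightarrow> (nat \<Rightarrow> nat \<Rightarrow> real mat) \<Rightarrow> (nat \<Rightarrow> nat \<Rightarrow> real mat) \<Rightarrow> nat \<Rightarrow> real mat" where
  "stacked_state m n X Y k = vstack m (2 * n) n (\<lambda>i. agent_state X Y i k)"

definition averaged_state ::
  "nat \<Rightarrow> (nat \<Rightarrow> nat \<Rightarrow> real mat) \<Rightarrow> (nat \<Rightarrow> nat \<Rightarrow> real mat) \<Rightarrow> nat \<Rightarrow> nat \<Rightarrow> real mat" where
  "averaged_state n X Y i k =
     (1 / real k) \<cdot>\<^sub>m mat_sum (2 * n) n (\<lambda>l. agent_state X Y i l) {1..k}"

end

theory Submission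
  imports Defs
begin

text \<open>A solution \<open>X\<close> of the Lyapunov equation gives a common zero \<open>p = (A X, X)\<close> of all local costs.
  For every such \<open>p\<close> the function \<open>V k = \<Sum>i. \<parallel>Z i k - p\<parallel>\<^sup>2 / \<alpha> i\<close> decreases in step \<open>k\<close> by at least
  \<open>\<Sum>i. (1 - \<alpha> i) / 2 * (\<Sum>j. a i j * \<parallel>Z i k - Z j k\<parallel>\<^sup>2) + 4 * (\<Sum>i. (1 - \<alpha> i \<xi> i) * f i (Z i k))\<close>:
  the adjacency rows sum to 1, so Jensen's inequality bounds the squared consensus step by the edge
  differences, and the squared gradient step is at most \<open>2 \<alpha> i\<^sup>2 \<xi> i f i\<close>. Hence the costs are
  summable, which with convexity gives the rate for the averages, and differences along active
  edges as well as the increments of the iterates vanish. Uniform connectivity turns this into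
  consensus, and by compactness a subsequence converges to a common zero \<open>p\<close>. Using this \<open>p\<close> in
  \<open>V\<close> gives convergence of the whole sequence.\<close>

section \<open>Perturbed consensus iterations in coordinates\<close>

text \<open>The weighted variance of \<open>d\<close> about its weighted mean \<open>\<mu>\<close>
  is nonnegative. This case of Jensen's inequality serves both the rows of the adjacency matrix and
  the averaging of residuals.\<close>

lemma weighted_square_sum_le:
  fixes w d :: "'b \<Rightarrow> real"
  assumes "\<And>j. j \<in> J \<Longrightarrow> 0 \<le> w j" and "sum w J = 1"
  shows "(\<Sum>j\<in>J. w j * d j)\<^sup>2 \<le> (\<Sum>j\<in>J. w j * (d j)\<^sup>2)"
proof -
  define \<mu> where "\<mu> = (\<Sum>j\<in>J. w j * d j)"
  have "0 \<le> (\<Sum>j\<in>J. w j * (d j - \<mu>)\<^sup>2)"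
    by (intro sum_nonneg) (simp add: assms)
  also have "\<dots> = (\<Sum>j\<in>J. w j * (d j)\<^sup>2 - 2 * \<mu> * (w j * d j) + \<mu>\<^sup>2 * w j)"
    by (intro sum.cong refl) (simp add: power2_eq_square algebra_simps)
  also have "\<dots> = (\<Sum>j\<in>J. w j * (d j)\<^sup>2) - 2 * \<mu> * \<mu> + \<mu>\<^sup>2 * sum w J"
    by (simp add: sum.distrib sum_subtractf \<mu>_def flip: sum_distrib_left)
  finally show ?thesis
    by (simp add: assms \<mu>_def power2_eq_square)
qed

text \<open>By symmetry of \<open>a\<close>, exchanging \<open>i\<close> and \<open>j\<close> leaves
  the double sum unchanged; adding both versions turns each summand into a square.\<close>

lemma laplacian_quadratic_form:
  fixes a :: "'b \<Rightarrow> 'b \<Rightarrow> real"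
  assumes "\<And>i j. i \<in> I \<Longrightarrow> j \<in> I \<Longrightarrow> a i j = a j i"
  shows "(\<Sum>i\<in>I. e i * (\<Sum>j\<in>I. a i j * (e i - e j)))
    = (\<Sum>i\<in>I. \<Sum>j\<in>I. a i j * (e i - e j)\<^sup>2) / 2"
proof -
  let ?S = "\<Sum>i\<in>I. \<Sum>j\<in>I. a i j * (e i * (e i - e j))"
  have "?S = (\<Sum>i\<in>I. \<Sum>j\<in>I. a j i * (e j * (e j - e i)))"
    by (rule sum.swap)
  also have "\<dots> = (\<Sum>i\<in>I. \<Sum>j\<in>I. a i j * (e j * (e j - e i)))"
    by (intro sum.cong refl) (simp add: assms)
  finally have "2 * ?S
      = (\<Sum>i\<in>I. \<Sum>j\<in>I. a i j * (e i * (e i - e j)) + a i j * (e j * (e j - e i)))"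
    by (simp add: sum.distrib)
  also have "\<dots> = (\<Sum>i\<in>I. \<Sum>j\<in>I. a i j * (e i - e j)\<^sup>2)"
    by (intro sum.cong refl) (simp add: power2_eq_square algebra_simps)
  finally have "?S = (\<Sum>i\<in>I. \<Sum>j\<in>I. a i j * (e i - e j)\<^sup>2) / 2"
    by linarith
  then show ?thesis
    by (simp add: sum_distrib_left mult.left_commute)
qed

text \<open>This treats one scalar coordinate. Dividing by \<open>\<alpha> i\<close> frees the cross
  term \<open>e i * L i\<close> from the step size, so the symmetric quadratic form applies although
  the agents use different steps. It yields half of each \<open>D i\<close>, of which the squared
  consensus step takes back at most the fraction \<open>\<alpha> i\<close>.\<close>

lemma consensus_step_descent:
  fixes a :: "'b \<Rightarrow> 'b \<Rightarrow> real"
  assumes sym: "\<And>i j. i \<in> I \<Longrightarrow> j \<in> I \<Longrightarrow> a i j = a j i"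
    and nonneg: "\<And>i j. i \<in> I \<Longrightarrow> j \<in> I \<Longrightarrow> 0 \<le> a i j"
    and row: "\<And>i. i \<in> I \<Longrightarrow> (\<Sum>j\<in>I. a i j) = 1"
    and pos: "\<And>i. i \<in> I \<Longrightarrow> 0 < \<alpha> i"
  shows "(\<Sum>i\<in>I. (e i - \<alpha> i * g i - \<alpha> i / 2 * (\<Sum>j\<in>I. a i j * (e i - e j)))\<^sup>2 / \<alpha> i)
    \<le> (\<Sum>i\<in>I. (e i)\<^sup>2 / \<alpha> i) - (\<Sum>i\<in>I. (1 - \<alpha> i) / 2 * (\<Sum>j\<in>I. a i j * (e i - e j)\<^sup>2))
      - 2 * (\<Sum>i\<in>I. e i * g i) + 2 * (\<Sum>i\<in>I. \<alpha> i * (g i)\<^sup>2)"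
proof -
  define L where "L i = (\<Sum>j\<in>I. a i j * (e i - e j))" for i
  define D where "D i = (\<Sum>j\<in>I. a i j * (e i - e j)\<^sup>2)" for i
  have "(e i - \<alpha> i * g i - \<alpha> i / 2 * L i)\<^sup>2 / \<alpha> i
      \<le> (e i)\<^sup>2 / \<alpha> i - e i * L i - 2 * (e i * g i) + 2 * (\<alpha> i * (g i)\<^sup>2) + \<alpha> i / 2 * D i"
    if i: "i \<in> I" for i
  proof -
    have "(e i - \<alpha> i * g i - \<alpha> i / 2 * L i)\<^sup>2 / \<alpha> i
        = (e i)\<^sup>2 / \<alpha> i - e i * L i - 2 * (e i * g i) + \<alpha> i * (g i + L i / 2)\<^sup>2" (is "?l = ?r")
      using pos[OF i] by (simp add: power2_eq_square field_simps)
    \<comment> \<open>The square of a sum is at most twice the sum of the squares. The resulting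
      factor 2 on the gradient is what later produces the weight
      \<open>1 - \<alpha> i * \<xi> i\<close>.\<close>
    moreover have "(g i + L i / 2)\<^sup>2 \<le> 2 * (g i)\<^sup>2 + (L i)\<^sup>2 / 2"
      using zero_le_power2[of "g i - L i / 2"] by (simp add: power2_eq_square algebra_simps)
    moreover have "(L i)\<^sup>2 \<le> D i"
      unfolding L_def D_def using i by (intro weighted_square_sum_le nonneg row)
    ultimately have "(g i + L i / 2)\<^sup>2 \<le> 2 * (g i)\<^sup>2 + D i / 2"
      by linarith
    from mult_left_mono[OF this less_imp_le[OF pos[OF i]]]
    have "\<alpha> i * (g i + L i / 2)\<^sup>2 \<le> 2 * (\<alpha> i * (g i)\<^sup>2) + \<alpha> i / 2 * D i"
      by (simp add: algebra_simps)
    with \<open>?l = ?r\<close> show ?thesis by linarith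
  qed
  then have "(\<Sum>i\<in>I. (e i - \<alpha> i * g i - \<alpha> i / 2 * L i)\<^sup>2 / \<alpha> i)
      \<le> (\<Sum>i\<in>I. (e i)\<^sup>2 / \<alpha> i - e i * L i - 2 * (e i * g i) + 2 * (\<alpha> i * (g i)\<^sup>2) + \<alpha> i / 2 * D i)"
    by (intro sum_mono)
  also have "\<dots> = (\<Sum>i\<in>I. (e i)\<^sup>2 / \<alpha> i) - (\<Sum>i\<in>I. e i * L i) - 2 * (\<Sum>i\<in>I. e i * g i)
      + 2 * (\<Sum>i\<in>I. \<alpha> i * (g i)\<^sup>2) + (\<Sum>i\<in>I. \<alpha> i / 2 * D i)"
    by (simp add: sum.distrib sum_subtractf sum_distrib_left)
  also have "(\<Sum>i\<in>I. e i * L i) = (\<Sum>i\<in>I. D i) / 2"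
    unfolding L_def D_def using sym by (rule laplacian_quadratic_form)
  also have "(\<Sum>i\<in>I. (e i)\<^sup>2 / \<alpha> i) - (\<Sum>i\<in>I. D i) / 2 - 2 * (\<Sum>i\<in>I. e i * g i)
      + 2 * (\<Sum>i\<in>I. \<alpha> i * (g i)\<^sup>2) + (\<Sum>i\<in>I. \<alpha> i / 2 * D i)
      = (\<Sum>i\<in>I. (e i)\<^sup>2 / \<alpha> i) - (\<Sum>i\<in>I. (1 - \<alpha> i) / 2 * D i)
      - 2 * (\<Sum>i\<in>I. e i * g i) + 2 * (\<Sum>i\<in>I. \<alpha> i * (g i)\<^sup>2)"
    by (simp add: sum_divide_distrib algebra_simps diff_divide_distrib sum_subtractf)
  finally show ?thesis by (simp only: L_def D_def)
qed

text \<open>Bolzano-Weierstrass for finitely many coordinates: each new coordinate is made monotone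
  along a further subsequence, which preserves the limits already obtained.\<close>

lemma bounded_coordinates_convergent_subseq:
  fixes x :: "nat \<Rightarrow> 's \<Rightarrow> real"
  assumes "finite S" and "\<And>s. s \<in> S \<Longrightarrow> Bseq (\<lambda>k. x k s)"
  shows "\<exists>l r. strict_mono (r :: nat \<Rightarrow> nat) \<and> (\<forall>s\<in>S. (\<lambda>k. x (r k) s) \<longlonglongrightarrow> l s)"
  using assms
proof (induction S rule: finite_induct)
  case empty
  show ?case by (auto intro: exI[of _ id] strict_mono_id)
next
  case (insert t S)
  then obtain l r where r: "strict_mono (r :: nat \<Rightarrow> nat)"
    and l: "\<And>s. s \<in> S \<Longrightarrow> (\<lambda>k. x (r k) s) \<longlonglongrightarrow> l s"
    by auto
  obtain q where q: "strict_mono (q :: nat \<Rightarrow> nat)" "monoseq (\<lambda>k. x (r (q k)) t)"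
    using seq_monosub[of "\<lambda>k. x (r k) t"] by auto
  have "Bseq (\<lambda>k. x (r (q k)) t)"
    using Bseq_subseq[OF insert.prems[of t], of "r \<circ> q"] by simp
  then obtain L where L: "(\<lambda>k. x (r (q k)) t) \<longlonglongrightarrow> L"
    using q(2) Bseq_monoseq_convergent convergent_def by blast
  have "(\<lambda>k. x (r (q k)) s) \<longlonglongrightarrow> l s" if "s \<in> S" for s
    using LIMSEQ_subseq_LIMSEQ[OF l[OF that] q(1)] by (simp add: o_def)
  then have "\<forall>s\<in>insert t S. (\<lambda>k. x ((r \<circ> q) k) s) \<longlonglongrightarrow> (l(t := L)) s"
    using L insert.hyps by auto
  with strict_mono_o[OF r q(1)] show ?case by blast
qed

text \<open>Triangle inequality along a path with \<open>n\<close> edges.\<close>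

lemma abs_diff_le_relpow:
  fixes x :: "'b \<Rightarrow> real"
  assumes "(i, j) \<in> E ^^ n" and "\<And>i j. (i, j) \<in> E \<Longrightarrow> \<bar>x i - x j\<bar> \<le> \<delta>"
  shows "\<bar>x i - x j\<bar> \<le> real n * \<delta>"
  using assms(1)
proof (induction n arbitrary: j)
  case (Suc n)
  then obtain h where h: "(i, h) \<in> E ^^ n" "(h, j) \<in> E" by auto
  from Suc.IH[OF h(1)] assms(2)[OF h(2)] show ?case by (simp add: algebra_simps)
qed auto

lemma tendsto_0_if_square_le:
  fixes f h :: "nat \<Rightarrow> real"
  assumes "h \<longlonglongrightarrow> 0" "\<And>k. (f k)\<^sup>2 \<le> h k"
  shows "f \<longlonglongrightarrow> 0"
proof -
  have "(\<lambda>k. (f k)\<^sup>2) \<longlonglongrightarrow> 0"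
    by (rule tendsto_sandwich[OF _ _ tendsto_const assms(1)]) (auto simp: assms(2))
  then have "(\<lambda>k. sqrt ((f k)\<^sup>2)) \<longlonglongrightarrow> sqrt 0"
    by (rule tendsto_real_sqrt)
  then show ?thesis by (simp add: tendsto_rabs_zero_iff)
qed

text \<open>The convergence argument needs only scalar coordinates \<open>s\<close> in
  \<open>S\<close>. Here \<open>g\<close> is the local gradient, \<open>P\<close> the set of common
  solutions, and \<open>R k i\<close> measures how far agent \<open>i\<close> is from solving its
  local problem. \<open>grad_inner\<close> holds against every solution at once, and
  \<open>P_closed\<close> replaces continuity of the costs: a limit of the iterates along a
  subsequence is a solution once all \<open>R\<close> vanish.\<close>

locale consensus_descent =
  fixes S :: "'s set" and m :: nat and a :: "nat \<Rightarrow> nat \<Rightarrow> nat \<Rightarrow> real" and \<alpha> \<xi> :: "nat \<Rightarrow> real"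
    and z g :: "nat \<Rightarrow> nat \<Rightarrow> 's \<Rightarrow> real" and R :: "nat \<Rightarrow> nat \<Rightarrow> real" and P :: "('s \<Rightarrow> real) set"
    and \<eta> :: real and B :: nat
  assumes finite_S: "finite S" and m_pos: "0 < m"
    and a_sym: "i < m \<Longrightarrow> j < m \<Longrightarrow> a k i j = a k j i"
    and a_nonneg: "i < m \<Longrightarrow> j < m \<Longrightarrow> 0 \<le> a k i j"
    and a_row: "i < m \<Longrightarrow> (\<Sum>j<m. a k i j) = 1"
    and \<eta>_pos: "0 < \<eta>"
    and a_lower: "i < m \<Longrightarrow> j < m \<Longrightarrow> 0 < a k i j \<Longrightarrow> \<eta> \<le> a k i j"
    and step_pos: "i < m \<Longrightarrow> 0 < \<alpha> i" and step_less_1: "i < m \<Longrightarrow> \<alpha> i < 1"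
    and step_\<xi>: "i < m \<Longrightarrow> \<alpha> i * \<xi> i < 1"
    and iter: "i < m \<Longrightarrow> s \<in> S \<Longrightarrow>
      z (Suc k) i s = z k i s - \<alpha> i * g k i s - \<alpha> i / 2 * (\<Sum>j<m. a k i j * (z k i s - z k j s))"
    and R_nonneg: "i < m \<Longrightarrow> 0 \<le> R k i"
    and grad_inner: "p \<in> P \<Longrightarrow> i < m \<Longrightarrow> (\<Sum>s\<in>S. (z k i s - p s) * g k i s) = R k i"
    and grad_bound: "i < m \<Longrightarrow> (\<Sum>s\<in>S. (g k i s)\<^sup>2) \<le> \<xi> i * R k i"
    and connected_union: "i < m \<Longrightarrow> j < m \<Longrightarrow>
      (i, j) \<in> {(i, j). i < m \<and> j < m \<and> (\<exists>t\<in>{k..<k + B}. 0 < a t i j)}\<^sup>*"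
    and P_closed: "strict_mono r \<Longrightarrow>
      (\<And>i s. i < m \<Longrightarrow> s \<in> S \<Longrightarrow> (\<lambda>k. z (r k) i s) \<longlonglongrightarrow> p s) \<Longrightarrow>
      (\<And>i. i < m \<Longrightarrow> (\<lambda>k. R k i) \<longlonglongrightarrow> 0) \<Longrightarrow> p \<in> P"
    and P_nonempty: "P \<noteq> {}"
begin

section \<open>The weighted distance to a solution and its decrease\<close>

definition V :: "('s \<Rightarrow> real) \<Rightarrow> nat \<Rightarrow> real" where
  "V p k = (\<Sum>i<m. \<Sum>s\<in>S. (z k i s - p s)\<^sup>2 / \<alpha> i)"

text \<open>The guaranteed decrease does not mention the solution \<open>p\<close>, so its
  summability, obtained from one solution, is available for all of them.\<close>

definition decrement :: "nat \<Rightarrow> real" where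
  "decrement k = (\<Sum>s\<in>S. \<Sum>i<m. (1 - \<alpha> i) / 2 * (\<Sum>j<m. a k i j * (z k i s - z k j s)\<^sup>2))
    + 2 * (\<Sum>i<m. (1 - \<alpha> i * \<xi> i) * R k i)"

lemma V_Suc_le:
  assumes p: "p \<in> P"
  shows "V p (Suc k) \<le> V p k - decrement k"
proof -
  let ?D = "\<lambda>s. \<Sum>i<m. (1 - \<alpha> i) / 2 * (\<Sum>j<m. a k i j * (z k i s - z k j s)\<^sup>2)"
  have swap: "V p k = (\<Sum>s\<in>S. \<Sum>i<m. (z k i s - p s)\<^sup>2 / \<alpha> i)" for k
    unfolding V_def by (rule sum.swap)
  have "(\<Sum>i<m. (z (Suc k) i s - p s)\<^sup>2 / \<alpha> i)
      \<le> (\<Sum>i<m. (z k i s - p s)\<^sup>2 / \<alpha> i) - ?D s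
        - 2 * (\<Sum>i<m. (z k i s - p s) * g k i s) + 2 * (\<Sum>i<m. \<alpha> i * (g k i s)\<^sup>2)" if s: "s \<in> S" for s
  proof -
    \<comment> \<open>Subtracting the same \<open>p s\<close> from every agent leaves the
      differences between agents unchanged, so the errors obey the same recursion as the
      iterates.\<close>
    have "(\<Sum>i<m. (z (Suc k) i s - p s)\<^sup>2 / \<alpha> i)
        = (\<Sum>i<m. ((z k i s - p s) - \<alpha> i * g k i s
          - \<alpha> i / 2 * (\<Sum>j<m. a k i j * ((z k i s - p s) - (z k j s - p s))))\<^sup>2 / \<alpha> i)"
      by (intro sum.cong refl) (simp add: iter s algebra_simps)
    also have "\<dots> \<le> (\<Sum>i<m. (z k i s - p s)\<^sup>2 / \<alpha> i)
        - (\<Sum>i<m. (1 - \<alpha> i) / 2 * (\<Sum>j<m. a k i j * ((z k i s - p s) - (z k j s - p s))\<^sup>2))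
        - 2 * (\<Sum>i<m. (z k i s - p s) * g k i s) + 2 * (\<Sum>i<m. \<alpha> i * (g k i s)\<^sup>2)"
      by (intro consensus_step_descent) (auto simp: a_sym a_nonneg a_row step_pos)
    finally show ?thesis by simp
  qed
  then have "V p (Suc k) \<le> (\<Sum>s\<in>S. (\<Sum>i<m. (z k i s - p s)\<^sup>2 / \<alpha> i) - ?D s
      - 2 * (\<Sum>i<m. (z k i s - p s) * g k i s) + 2 * (\<Sum>i<m. \<alpha> i * (g k i s)\<^sup>2))"
    unfolding swap by (rule sum_mono)
  also have "\<dots> = V p k - (\<Sum>s\<in>S. ?D s) - 2 * (\<Sum>s\<in>S. \<Sum>i<m. (z k i s - p s) * g k i s)
      + 2 * (\<Sum>s\<in>S. \<Sum>i<m. \<alpha> i * (g k i s)\<^sup>2)"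
    by (simp add: swap sum.distrib sum_subtractf flip: sum_distrib_left)
  also have "(\<Sum>s\<in>S. \<Sum>i<m. (z k i s - p s) * g k i s) = (\<Sum>i<m. R k i)"
    by (subst sum.swap) (simp add: grad_inner p)
  also have "(\<Sum>s\<in>S. \<Sum>i<m. \<alpha> i * (g k i s)\<^sup>2) = (\<Sum>i<m. \<alpha> i * (\<Sum>s\<in>S. (g k i s)\<^sup>2))"
    by (subst sum.swap) (simp add: sum_distrib_left)
  \<comment> \<open>By \<open>grad_bound\<close> the squared gradient costs at most
    \<open>2 * \<alpha> i * \<xi> i * R k i\<close>, while the inner product gained
    \<open>2 * R k i\<close>.\<close>
  also have "V p k - (\<Sum>s\<in>S. ?D s) - 2 * (\<Sum>i<m. R k i)
      + 2 * (\<Sum>i<m. \<alpha> i * (\<Sum>s\<in>S. (g k i s)\<^sup>2))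
      \<le> V p k - (\<Sum>s\<in>S. ?D s) - 2 * (\<Sum>i<m. R k i) + 2 * (\<Sum>i<m. \<alpha> i * (\<xi> i * R k i))"
    by (intro add_left_mono mult_left_mono sum_mono) (auto simp: grad_bound less_imp_le[OF step_pos])
  also have "\<dots> = V p k - decrement k"
    by (simp add: decrement_def algebra_simps sum_subtractf)
  finally show ?thesis .
qed

lemma weighted_R_nonneg: "i < m \<Longrightarrow> 0 \<le> (1 - \<alpha> i * \<xi> i) * R k i"
  using step_\<xi>[of i] by (simp add: R_nonneg)

lemma R_le_decrement: "2 * (\<Sum>i<m. (1 - \<alpha> i * \<xi> i) * R k i) \<le> decrement k"
  unfolding decrement_def
  by (auto intro!: sum_nonneg mult_nonneg_nonneg a_nonneg simp: less_imp_le[OF step_less_1])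

lemma edge_le_decrement:
  assumes "s \<in> S" "i < m" "j < m"
  shows "(1 - \<alpha> i) / 2 * (a k i j * (z k i s - z k j s)\<^sup>2) \<le> decrement k"
proof -
  have nn: "0 \<le> (1 - \<alpha> i) / 2 * (\<Sum>j<m. a k i j * (z k i s - z k j s)\<^sup>2)" if "i < m" for s i
    using that by (auto intro!: sum_nonneg mult_nonneg_nonneg a_nonneg simp: less_imp_le[OF step_less_1])
  have "(1 - \<alpha> i) / 2 * (a k i j * (z k i s - z k j s)\<^sup>2)
      \<le> (1 - \<alpha> i) / 2 * (\<Sum>j<m. a k i j * (z k i s - z k j s)\<^sup>2)"
    using assms step_less_1[of i]
    by (intro mult_left_mono member_le_sum) (auto simp: a_nonneg)
  also have "\<dots> \<le> (\<Sum>i<m. (1 - \<alpha> i) / 2 * (\<Sum>j<m. a k i j * (z k i s - z k j s)\<^sup>2))"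
    using assms nn by (intro member_le_sum[of i]) auto
  also have "\<dots> \<le> (\<Sum>s\<in>S. \<Sum>i<m. (1 - \<alpha> i) / 2 * (\<Sum>j<m. a k i j * (z k i s - z k j s)\<^sup>2))"
    using assms nn finite_S
    by (intro member_le_sum[where f = "\<lambda>s. \<Sum>i<m. (1 - \<alpha> i) / 2 * (\<Sum>j<m. a k i j * (z k i s - z k j s)\<^sup>2)"]
        sum_nonneg) auto
  also have "\<dots> \<le> decrement k"
    unfolding decrement_def using sum_nonneg[of "{..<m}", OF weighted_R_nonneg] by simp
  finally show ?thesis .
qed

lemma decrement_nonneg: "0 \<le> decrement k"
  using R_le_decrement[of k] weighted_R_nonneg[of _ k] sum_nonneg[of "{..<m}" "\<lambda>i. (1 - \<alpha> i * \<xi> i) * R k i"]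
  by force

lemma V_nonneg: "0 \<le> V p k"
  unfolding V_def by (auto intro!: sum_nonneg divide_nonneg_pos step_pos)

lemma decseq_V: "p \<in> P \<Longrightarrow> decseq (V p)"
  using V_Suc_le[of p] decrement_nonneg by (intro decseq_SucI) (smt (verit))

lemma sum_decrement_le: "p \<in> P \<Longrightarrow> (\<Sum>k<N. decrement k) \<le> V p 0 - V p N"
  using V_Suc_le[of p] by (induction N) (auto, smt (verit))

text \<open>The decrease of \<open>V\<close> telescopes and \<open>V\<close> is nonnegative. This
  bound on the accumulated costs is the source of the \<open>1 / k\<close> rate for the
  averages.\<close>

lemma R_partial_sums_bounded:
  "\<exists>C. \<forall>N. (\<Sum>k<N. \<Sum>i<m. (1 - \<alpha> i * \<xi> i) * R k i) \<le> C"
proof -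
  obtain p where p: "p \<in> P" using P_nonempty by auto
  have "2 * (\<Sum>k<N. \<Sum>i<m. (1 - \<alpha> i * \<xi> i) * R k i) \<le> V p 0" for N
  proof -
    have "2 * (\<Sum>k<N. \<Sum>i<m. (1 - \<alpha> i * \<xi> i) * R k i) \<le> (\<Sum>k<N. decrement k)"
      by (subst sum_distrib_left) (intro sum_mono R_le_decrement)
    with sum_decrement_le[OF p, of N] V_nonneg[of p N] show ?thesis by linarith
  qed
  then show ?thesis by (intro exI[of _ "V p 0 / 2"]) (simp add: field_simps)
qed

section \<open>Vanishing costs, gradients, increments and disagreements\<close>

lemma decrement_tendsto_0: "decrement \<longlonglongrightarrow> 0"
proof -
  obtain p where p: "p \<in> P" using P_nonempty by auto
  have "summable decrement"
  proof (rule summableI_nonneg_bounded[OF decrement_nonneg])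
    show "(\<Sum>k<N. decrement k) \<le> V p 0" for N
      using sum_decrement_le[OF p, of N] V_nonneg[of p N] by linarith
  qed
  then show ?thesis by (rule summable_LIMSEQ_zero)
qed

lemma R_tendsto_0:
  assumes i: "i < m"
  shows "(\<lambda>k. R k i) \<longlonglongrightarrow> 0"
proof (rule tendsto_sandwich[OF _ _ tendsto_const])
  show "(\<lambda>k. decrement k / (2 * (1 - \<alpha> i * \<xi> i))) \<longlonglongrightarrow> 0"
    using tendsto_divide[OF decrement_tendsto_0 tendsto_const, of "2 * (1 - \<alpha> i * \<xi> i)"] step_\<xi>[OF i] by simp
  have "R k i \<le> decrement k / (2 * (1 - \<alpha> i * \<xi> i))" for k
  proof -
    have "(1 - \<alpha> i * \<xi> i) * R k i \<le> (\<Sum>i<m. (1 - \<alpha> i * \<xi> i) * R k i)"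
      using i weighted_R_nonneg by (intro member_le_sum[of i]) auto
    with R_le_decrement[of k] step_\<xi>[OF i] show ?thesis by (simp add: field_simps)
  qed
  then show "\<forall>\<^sub>F k in sequentially. R k i \<le> decrement k / (2 * (1 - \<alpha> i * \<xi> i))" by simp
qed (simp add: R_nonneg i)

lemma g_tendsto_0:
  assumes "i < m" "s \<in> S"
  shows "(\<lambda>k. g k i s) \<longlonglongrightarrow> 0"
proof (rule tendsto_0_if_square_le)
  show "(\<lambda>k. \<xi> i * R k i) \<longlonglongrightarrow> 0"
    using tendsto_mult_right_zero[OF R_tendsto_0[OF assms(1)]] .
  show "(g k i s)\<^sup>2 \<le> \<xi> i * R k i" for k
    using member_le_sum[of s S "\<lambda>s. (g k i s)\<^sup>2"] grad_bound[OF assms(1), of k] finite_S assms(2)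
    by force
qed

lemma a_le_1: "i < m \<Longrightarrow> j < m \<Longrightarrow> a k i j \<le> 1"
  using member_le_sum[of j "{..<m}" "a k i"] by (simp add: a_row a_nonneg)

text \<open>The factor \<open>a k i j\<close> stays in the statement because an inactive edge
  controls no difference. The decrement contains \<open>a\<close> only to the first power, and
  \<open>a \<le> 1\<close> bounds the square by it.\<close>

lemma edge_tendsto_0:
  assumes "i < m" "j < m" "s \<in> S"
  shows "(\<lambda>k. a k i j * (z k i s - z k j s)) \<longlonglongrightarrow> 0"
proof (rule tendsto_0_if_square_le)
  show "(\<lambda>k. decrement k / ((1 - \<alpha> i) / 2)) \<longlonglongrightarrow> 0"
    using tendsto_divide[OF decrement_tendsto_0 tendsto_const, of "(1 - \<alpha> i) / 2"] step_less_1[OF assms(1)] by simp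
  fix k
  have "(a k i j * (z k i s - z k j s))\<^sup>2 = a k i j * (a k i j * (z k i s - z k j s)\<^sup>2)"
    by (simp add: power2_eq_square)
  also have "\<dots> \<le> 1 * (a k i j * (z k i s - z k j s)\<^sup>2)"
    using assms by (intro mult_right_mono) (auto simp: a_le_1 a_nonneg)
  also have "\<dots> \<le> decrement k / ((1 - \<alpha> i) / 2)"
    using edge_le_decrement[OF assms(3,1,2), of k] step_less_1[OF assms(1)] by (simp add: field_simps)
  finally show "(a k i j * (z k i s - z k j s))\<^sup>2 \<le> decrement k / ((1 - \<alpha> i) / 2)" .
qed

text \<open>Each increment combines a gradient with weighted edge differences, all of which vanish;
  \<open>t\<close> of them are added up. This allows comparing states at different times within one
  connectivity window.\<close>

lemma drift_tendsto_0:
  assumes i: "i < m" and s: "s \<in> S"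
  shows "(\<lambda>k. z (k + t) i s - z k i s) \<longlonglongrightarrow> 0"
proof (induction t)
  case (Suc t)
  have "(\<lambda>k. - (\<alpha> i * g k i s) - \<alpha> i / 2 * (\<Sum>j<m. a k i j * (z k i s - z k j s)))
      \<longlonglongrightarrow> - (\<alpha> i * 0) - \<alpha> i / 2 * (\<Sum>j<m. 0)"
    by (intro tendsto_intros g_tendsto_0 edge_tendsto_0) (auto simp: i s)
  then have "(\<lambda>k. z (Suc k) i s - z k i s) \<longlonglongrightarrow> 0"
    by (simp add: iter i s algebra_simps)
  from LIMSEQ_ignore_initial_segment[OF this, of t] tendsto_add[OF this Suc]
  have "(\<lambda>k. (z (Suc (k + t)) i s - z (k + t) i s) + (z (k + t) i s - z k i s)) \<longlonglongrightarrow> 0 + 0"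
    by (intro tendsto_add Suc)
  then show ?case by simp
qed simp

text \<open>Every edge of the union graph over a window of length \<open>B\<close> is active at some
  time in it. The difference across the edge is small at that time, small drift carries this back to
  time \<open>k\<close>, and a path joins any two agents.\<close>

lemma disagreement_tendsto_0:
  assumes i: "i < m" and j: "j < m" and s: "s \<in> S"
  shows "(\<lambda>k. z k i s - z k j s) \<longlonglongrightarrow> 0"
proof (rule LIMSEQ_I)
  fix \<epsilon> :: real assume \<epsilon>: "0 < \<epsilon>"
  define M where "M = card ({..<m} \<times> {..<m})"
  \<comment> \<open>Each edge costs \<open>3 * \<delta>\<close>: one \<open>\<delta>\<close> across
    the edge at its active time and one for the drift of each endpoint. A path needs at most
    \<open>M\<close> edges, and \<open>Suc M\<close> makes the final inequality strict.\<close>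
  define \<delta> where "\<delta> = \<epsilon> / (3 * real (Suc M))"
  have \<delta>: "0 < \<delta>" using \<epsilon> by (simp add: \<delta>_def)
  have "\<forall>\<^sub>F k in sequentially. \<forall>i\<in>{..<m}. \<forall>t\<in>{..<B}. \<bar>z (k + t) i s - z k i s\<bar> < \<delta>"
    using drift_tendsto_0[OF _ s] \<delta>
    by (intro eventually_ball_finite ballI finite_lessThan)
      (force simp: tendsto_iff dist_real_def)
  moreover have "\<forall>\<^sub>F k in sequentially. \<forall>i\<in>{..<m}. \<forall>j\<in>{..<m}. \<forall>t\<in>{..<B}.
      \<bar>a (k + t) i j * (z (k + t) i s - z (k + t) j s)\<bar> < \<eta> * \<delta>"
  proof (intro eventually_ball_finite ballI finite_lessThan)
    fix i j t assume "i \<in> {..<m}" "j \<in> {..<m}"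
    then have "(\<lambda>k. a (k + t) i j * (z (k + t) i s - z (k + t) j s)) \<longlonglongrightarrow> 0"
      using edge_tendsto_0[OF _ _ s, of i j] LIMSEQ_ignore_initial_segment by blast
    from tendstoD[OF this mult_pos_pos[OF \<eta>_pos \<delta>]]
    show "\<forall>\<^sub>F k in sequentially. \<bar>a (k + t) i j * (z (k + t) i s - z (k + t) j s)\<bar> < \<eta> * \<delta>"
      by (simp add: dist_real_def)
  qed
  ultimately have "\<forall>\<^sub>F k in sequentially. \<bar>z k i s - z k j s\<bar> < \<epsilon>"
  proof eventually_elim
    case (elim k)
    define E where "E = {(i, j). i < m \<and> j < m \<and> (\<exists>t\<in>{k..<k + B}. 0 < a t i j)}"
    have edge: "\<bar>z k i s - z k j s\<bar> \<le> 3 * \<delta>" if "(i, j) \<in> E" for i j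
    proof -
      from that obtain u where ij: "i < m" "j < m" and u: "u \<in> {k..<k + B}" "0 < a u i j"
        by (auto simp: E_def)
      define t where "t = u - k"
      have t: "t < B" "0 < a (k + t) i j" using u by (auto simp: t_def)
      \<comment> \<open>The uniform lower bound on active weights removes the weight from the edge
        difference.\<close>
      have "\<eta> * \<bar>z (k + t) i s - z (k + t) j s\<bar> \<le> \<bar>a (k + t) i j * (z (k + t) i s - z (k + t) j s)\<bar>"
        using a_lower[OF ij t(2)] t(2) by (simp add: abs_mult mult_right_mono)
      also have "\<dots> < \<eta> * \<delta>" using elim(2) ij t by simp
      finally have "\<bar>z (k + t) i s - z (k + t) j s\<bar> < \<delta>" using \<eta>_pos by simp
      moreover have "\<bar>z (k + t) i s - z k i s\<bar> < \<delta>" "\<bar>z (k + t) j s - z k j s\<bar> < \<delta>"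
        using elim(1) ij t by auto
      ultimately show ?thesis by linarith
    qed
    have fin: "finite ({..<m} \<times> {..<m})" and sub: "E \<subseteq> {..<m} \<times> {..<m}"
      by (auto simp: E_def)
    \<comment> \<open>The edge set \<open>E\<close> changes with \<open>k\<close>, whereas the bound
      \<open>M\<close> on the path length does not.\<close>
    have cardE: "card E \<le> M"
      unfolding M_def using fin sub by (rule card_mono)
    have "finite E" using sub fin by (rule finite_subset)
    moreover have "(i, j) \<in> E\<^sup>*" unfolding E_def using connected_union[OF i j] .
    ultimately obtain n where n: "n \<le> M" "(i, j) \<in> E ^^ n"
    proof (cases "E = {}")
      case True
      with \<open>(i, j) \<in> E\<^sup>*\<close> have "(i, j) \<in> E ^^ 0" by simp
      with that[of 0] show ?thesis by simp
    next
      case False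
      have "finite E \<Longrightarrow> (i, j) \<in> (\<Union>n\<in>{n. n \<le> card E}. E ^^ n)"
        using \<open>(i, j) \<in> E\<^sup>*\<close> rtrancl_finite_eq_relpow[of E] by simp
      with \<open>finite E\<close> cardE that show ?thesis by (auto intro: le_trans)
    qed
    from abs_diff_le_relpow[OF n(2), of "\<lambda>i. z k i s", OF edge]
    have "\<bar>z k i s - z k j s\<bar> \<le> real n * (3 * \<delta>)" .
    also have "\<dots> \<le> real M * (3 * \<delta>)" using n \<delta> by (intro mult_right_mono) auto
    also have "\<dots> < real (Suc M) * (3 * \<delta>)" using \<delta> by (intro mult_strict_right_mono) auto
    also have "\<dots> = \<epsilon>" by (simp add: \<delta>_def field_simps)
    finally show ?case .
  qed
  then show "\<exists>K. \<forall>k\<ge>K. norm (z k i s - z k j s - 0) < \<epsilon>"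
    by (simp add: eventually_sequentially)
qed

section \<open>Boundedness and convergence of the whole sequence\<close>

lemma square_le_V:
  assumes "i < m" "s \<in> S"
  shows "(z k i s - p s)\<^sup>2 \<le> \<alpha> i * V p k"
proof -
  have "(z k i s - p s)\<^sup>2 / \<alpha> i \<le> (\<Sum>s\<in>S. (z k i s - p s)\<^sup>2 / \<alpha> i)"
    using assms finite_S less_imp_le[OF step_pos]
    by (intro member_le_sum[where f = "\<lambda>s. (z k i s - p s)\<^sup>2 / \<alpha> i"]) auto
  also have "\<dots> \<le> V p k"
    unfolding V_def using assms less_imp_le[OF step_pos]
    by (intro member_le_sum[where f = "\<lambda>i. \<Sum>s\<in>S. (z k i s - p s)\<^sup>2 / \<alpha> i"] sum_nonneg) auto
  finally show ?thesis using step_pos[OF assms(1)] by (simp add: field_simps)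
qed

text \<open>Since \<open>V p\<close> never exceeds its initial value, every coordinate stays within
  a fixed distance of \<open>p\<close>.\<close>

lemma z_bounded:
  assumes "i < m" "s \<in> S"
  shows "Bseq (\<lambda>k. z k i s)"
proof -
  obtain p where p: "p \<in> P" using P_nonempty by auto
  have "\<bar>z k i s\<bar> \<le> sqrt (\<alpha> i * V p 0) + \<bar>p s\<bar>" for k
  proof -
    have "(z k i s - p s)\<^sup>2 \<le> \<alpha> i * V p 0"
      using square_le_V[OF assms, of k p] decseqD[OF decseq_V[OF p], of 0 k] step_pos[OF assms(1)]
      by (meson le0 less_imp_le mult_left_mono order_trans)
    then have "\<bar>z k i s - p s\<bar> \<le> sqrt (\<alpha> i * V p 0)"
      using real_le_rsqrt[of "\<bar>z k i s - p s\<bar>"] by simp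
    then show ?thesis by linarith
  qed
  then show ?thesis by (intro BseqI'[of _ "sqrt (\<alpha> i * V p 0) + \<bar>p s\<bar>"]) auto
qed

theorem converges_to_solution:
  "\<exists>p\<in>P. \<forall>i<m. \<forall>s\<in>S. (\<lambda>k. z k i s) \<longlonglongrightarrow> p s"
proof -
  obtain p r where r: "strict_mono (r :: nat \<Rightarrow> nat)"
    and p0: "\<And>s. s \<in> S \<Longrightarrow> (\<lambda>k. z (r k) 0 s) \<longlonglongrightarrow> p s"
    using bounded_coordinates_convergent_subseq[of S "\<lambda>k. z k 0", OF finite_S z_bounded[OF m_pos]]
    by blast
  \<comment> \<open>The subsequence was chosen for agent 0 only; vanishing disagreement carries the
    other agents to the same limit.\<close>
  have lim: "(\<lambda>k. z (r k) i s) \<longlonglongrightarrow> p s" if "i < m" "s \<in> S" for i s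
    using tendsto_add[OF p0[OF that(2)]
        LIMSEQ_subseq_LIMSEQ[OF disagreement_tendsto_0[OF that(1) m_pos that(2)] r]]
    by (simp add: o_def)
  have p: "p \<in> P"
    using P_closed[OF r] lim R_tendsto_0 by blast
  have "(\<lambda>k. V p (r k)) \<longlonglongrightarrow> (\<Sum>i<m. \<Sum>s\<in>S. (p s - p s)\<^sup>2 / \<alpha> i)"
    unfolding V_def using step_pos
    by (intro tendsto_intros lim) (auto simp: less_imp_neq[THEN not_sym])
  then have Vr: "(\<lambda>k. V p (r k)) \<longlonglongrightarrow> 0" by simp
  \<comment> \<open>For this particular \<open>p\<close>, the monotone sequence \<open>V p\<close>
    has a limit, and the subsequence identifies it as 0.\<close>
  obtain L where L: "V p \<longlonglongrightarrow> L"
    by (rule decseq_convergent[OF decseq_V[OF p], of 0]) (auto simp: V_nonneg)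
  have "L = 0"
    using LIMSEQ_unique[OF LIMSEQ_subseq_LIMSEQ[OF L r]] Vr by (simp add: o_def)
  with L have V0: "V p \<longlonglongrightarrow> 0" by simp
  have "(\<lambda>k. z k i s) \<longlonglongrightarrow> p s" if "i < m" "s \<in> S" for i s
  proof -
    have "(\<lambda>k. z k i s - p s) \<longlonglongrightarrow> 0"
      by (rule tendsto_0_if_square_le[OF tendsto_mult_right_zero[OF V0, of "\<alpha> i"]])
        (rule square_le_V[OF that])
    then show ?thesis by (rule LIM_zero_cancel)
  qed
  with p show ?thesis by blast
qed

end

section \<open>The Frobenius inner product\<close>

text \<open>The summation ranges come from the first argument alone, hence the carrier assumptions
  in the rules that modify or exchange arguments.\<close>

definition frob_inner :: "real mat \<Rightarrow> real mat \<Rightarrow> real" where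
  "frob_inner M N = (\<Sum>r<dim_row M. \<Sum>c<dim_col M. M $$ (r, c) * N $$ (r, c))"

lemma frob_norm_square: "(frob_norm M)\<^sup>2 = frob_inner M M"
  by (simp add: frob_norm_def frob_inner_def sum_nonneg power2_eq_square)

lemma frob_inner_nonneg: "0 \<le> frob_inner M M"
  by (simp add: frob_inner_def sum_nonneg)

lemma square_le_frob_inner:
  assumes "r < dim_row M" "c < dim_col M"
  shows "(M $$ (r, c))\<^sup>2 \<le> frob_inner M M"
proof -
  have "(M $$ (r, c))\<^sup>2 \<le> (\<Sum>c<dim_col M. M $$ (r, c) * M $$ (r, c))"
    using assms member_le_sum[of c "{..<dim_col M}" "\<lambda>c. M $$ (r, c) * M $$ (r, c)"]
    by (simp add: power2_eq_square)
  also have "\<dots> \<le> frob_inner M M"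
    unfolding frob_inner_def using assms
    by (intro member_le_sum[where f = "\<lambda>r. \<Sum>c<dim_col M. M $$ (r, c) * M $$ (r, c)"] sum_nonneg) auto
  finally show ?thesis .
qed

section \<open>Bilinearity and adjoints of multiplication\<close>

lemma frob_inner_minus_left:
  "M \<in> carrier_mat nr nc \<Longrightarrow> M' \<in> carrier_mat nr nc \<Longrightarrow>
    frob_inner (M - M') N = frob_inner M N - frob_inner M' N"
  by (simp add: frob_inner_def sum_subtractf left_diff_distrib)

lemma frob_inner_add_right:
  "N \<in> carrier_mat nr nc \<Longrightarrow> N' \<in> carrier_mat nr nc \<Longrightarrow> M \<in> carrier_mat nr nc \<Longrightarrow>
    frob_inner M (N + N') = frob_inner M N + frob_inner M N'"
  by (simp add: frob_inner_def sum.distrib distrib_left)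

lemma frob_inner_minus_right:
  "N \<in> carrier_mat nr nc \<Longrightarrow> N' \<in> carrier_mat nr nc \<Longrightarrow> M \<in> carrier_mat nr nc \<Longrightarrow>
    frob_inner M (N - N') = frob_inner M N - frob_inner M N'"
  by (simp add: frob_inner_def sum_subtractf right_diff_distrib)

lemma frob_inner_uminus_right:
  "N \<in> carrier_mat nr nc \<Longrightarrow> M \<in> carrier_mat nr nc \<Longrightarrow>
    frob_inner M (- N) = - frob_inner M N"
  by (simp add: frob_inner_def sum_negf)

lemma index_mult_mat_sum:
  assumes "M \<in> carrier_mat p q" "N \<in> carrier_mat q t" "r < p" "c < t"
  shows "(M * N) $$ (r, c) = (\<Sum>l<q. M $$ (r, l) * N $$ (l, c))"
  using assms by (auto simp: scalar_prod_def lessThan_atLeast0)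

text \<open>Both sides are the triple sum of \<open>M $$ (r, l) * N $$ (l, c) * T $$ (r, c)\<close>
  in different orders: the adjoint of left multiplication by \<open>M\<close> is left multiplication
  by its transpose.\<close>

lemma frob_inner_mult_left:
  assumes M: "M \<in> carrier_mat p q" and N: "N \<in> carrier_mat q t" and T: "T \<in> carrier_mat p t"
  shows "frob_inner (M * N) T = frob_inner N (M\<^sup>T * T)"
proof -
  have "frob_inner (M * N) T = (\<Sum>r<p. \<Sum>c<t. (\<Sum>l<q. M $$ (r, l) * N $$ (l, c)) * T $$ (r, c))"
    using M N unfolding frob_inner_def
    by (intro sum.cong) (auto simp: index_mult_mat_sum[OF M N] simp del: index_mult_mat(1))
  also have "\<dots> = (\<Sum>r<p. \<Sum>c<t. \<Sum>l<q. N $$ (l, c) * (M $$ (r, l) * T $$ (r, c)))"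
    by (simp add: sum_distrib_right mult.assoc mult.left_commute)
  also have "\<dots> = (\<Sum>r<p. \<Sum>l<q. \<Sum>c<t. N $$ (l, c) * (M $$ (r, l) * T $$ (r, c)))"
    by (intro sum.cong refl sum.swap)
  also have "\<dots> = (\<Sum>l<q. \<Sum>r<p. \<Sum>c<t. N $$ (l, c) * (M $$ (r, l) * T $$ (r, c)))"
    by (rule sum.swap)
  also have "\<dots> = (\<Sum>l<q. \<Sum>c<t. \<Sum>r<p. N $$ (l, c) * (M $$ (r, l) * T $$ (r, c)))"
    by (intro sum.cong refl sum.swap)
  also have "\<dots> = (\<Sum>l<q. \<Sum>c<t. N $$ (l, c) * (M\<^sup>T * T) $$ (l, c))"
    using M T by (intro sum.cong refl)
      (simp add: index_mult_mat_sum[of "M\<^sup>T" q p T t] sum_distrib_left del: index_mult_mat)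
  also have "\<dots> = frob_inner N (M\<^sup>T * T)"
    using N by (simp add: frob_inner_def)
  finally show ?thesis .
qed

lemma frob_inner_transpose:
  "M \<in> carrier_mat p q \<Longrightarrow> N \<in> carrier_mat p q \<Longrightarrow> frob_inner (M\<^sup>T) (N\<^sup>T) = frob_inner M N"
  unfolding frob_inner_def by (subst sum.swap) simp

text \<open>Transposing both arguments reduces this to \<open>frob_inner_mult_left\<close>.\<close>

lemma frob_inner_mult_right:
  assumes M: "M \<in> carrier_mat p q" and N: "N \<in> carrier_mat q t" and T: "T \<in> carrier_mat p t"
  shows "frob_inner (M * N) T = frob_inner M (T * N\<^sup>T)"
proof -
  have "frob_inner (M * N) T = frob_inner ((M * N)\<^sup>T) (T\<^sup>T)"
    using M N T by (simp add: frob_inner_transpose[of _ p t])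
  also have "\<dots> = frob_inner (N\<^sup>T * M\<^sup>T) (T\<^sup>T)"
    using transpose_mult[OF M N] by simp
  also have "\<dots> = frob_inner (M\<^sup>T) (N * T\<^sup>T)"
    using frob_inner_mult_left[of "N\<^sup>T" t q "M\<^sup>T" p "T\<^sup>T"] M N T by simp
  also have "N * T\<^sup>T = (T * N\<^sup>T)\<^sup>T"
    using transpose_mult[of T p t "N\<^sup>T" q] N T by simp
  also have "frob_inner (M\<^sup>T) ((T * N\<^sup>T)\<^sup>T) = frob_inner M (T * N\<^sup>T)"
    using M N T by (intro frob_inner_transpose[of _ p q]) auto
  finally show ?thesis .
qed

lemma minus_minus_swap_mat:
  fixes M :: "'a :: ab_group_add mat"
  assumes "M \<in> carrier_mat nr nc" "M' \<in> carrier_mat nr nc" "N \<in> carrier_mat nr nc" "N' \<in> carrier_mat nr nc"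
  shows "(M - N) - (M' - N') = (M - M') - (N - N')"
  using assms by (intro eq_matI) auto

lemma minus_minus_add_swap_mat:
  fixes M :: "'a :: ab_group_add mat"
  assumes "M \<in> carrier_mat nr nc" "M' \<in> carrier_mat nr nc" "N \<in> carrier_mat nr nc" "N' \<in> carrier_mat nr nc"
    and "K \<in> carrier_mat nr nc"
  shows "(M - N + K) - (M' - N' + K) = (M - M') - (N - N')"
  using assms by (intro eq_matI) auto

lemma minus_zero_mat:
  fixes M :: "'a :: ab_group_add mat"
  assumes "M \<in> carrier_mat nr nc"
  shows "M - 0\<^sub>m nr nc = M"
  using assms by (intro eq_matI) auto

section \<open>Residuals and gradients of the local costs\<close>

locale block_partition =
  fixes m n :: nat and ns :: "nat \<Rightarrow> nat" and A Q :: "real mat"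
  assumes ns_sum: "(\<Sum>i<m. ns i) = n"
    and A_carrier: "A \<in> carrier_mat n n" and Q_carrier: "Q \<in> carrier_mat n n"
begin

section \<open>Dimensions and entries of blocks and residuals\<close>

lemma block_offset_less:
  assumes "i < m" "r < ns i"
  shows "block_offset ns i + r < n"
proof -
  have "block_offset ns i + ns i = (\<Sum>j<Suc i. ns j)" by (simp add: block_offset_def)
  also have "\<dots> \<le> (\<Sum>j<m. ns j)" using assms by (intro sum_mono2) auto
  finally show ?thesis using assms ns_sum by simp
qed

lemma row_block_carrier [simp]: "M \<in> carrier_mat q n \<Longrightarrow> row_block ns i M \<in> carrier_mat (ns i) n"
  by (auto simp: row_block_def)

lemma col_block_carrier [simp]: "M \<in> carrier_mat n q \<Longrightarrow> col_block ns i M \<in> carrier_mat n (ns i)"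
  by (auto simp: col_block_def)

lemma E_col_carrier [simp]: "E_col n ns i \<in> carrier_mat n (ns i)"
  by (simp add: E_col_def col_block_def)

lemma row_residual_carrier [simp]:
  "X \<in> carrier_mat n n \<Longrightarrow> Y \<in> carrier_mat n n \<Longrightarrow> row_residual ns A i X Y \<in> carrier_mat (ns i) n"
  unfolding row_residual_def using A_carrier by (intro minus_carrier_mat mult_carrier_mat) auto

lemma col_residual_carrier [simp]:
  "X \<in> carrier_mat n n \<Longrightarrow> Y \<in> carrier_mat n n \<Longrightarrow> col_residual n ns A Q i X Y \<in> carrier_mat n (ns i)"
  unfolding col_residual_def using Q_carrier by (intro add_carrier_mat) auto

lemma d_X_carrier [simp]:
  "X \<in> carrier_mat n n \<Longrightarrow> Y \<in> carrier_mat n n \<Longrightarrow> d_X n ns A Q i X Y \<in> carrier_mat n n"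
  unfolding d_X_def
  by (intro minus_carrier_mat mult_carrier_mat[where n = "ns i"] col_residual_carrier) auto

lemma d_Y_carrier [simp]:
  "X \<in> carrier_mat n n \<Longrightarrow> Y \<in> carrier_mat n n \<Longrightarrow> d_Y n ns A Q i X Y \<in> carrier_mat n n"
  unfolding d_Y_def using A_carrier
  by (intro add_carrier_mat mult_carrier_mat[where n = "ns i"] col_residual_carrier) auto

lemma index_mult_E_col:
  assumes "M \<in> carrier_mat q n" "i < m" "r < q" "c < ns i"
  shows "(M * E_col n ns i) $$ (r, c) = M $$ (r, block_offset ns i + c)"
proof -
  have "(M * E_col n ns i) $$ (r, c) = (\<Sum>l<n. M $$ (r, l) * E_col n ns i $$ (l, c))"
    using assms by (intro index_mult_mat_sum) auto
  also have "\<dots> = (\<Sum>l<n. if l = block_offset ns i + c then M $$ (r, l) else 0)"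
    using assms block_offset_less[of i c]
    by (intro sum.cong refl) (auto simp: E_col_def col_block_def)
  also have "\<dots> = M $$ (r, block_offset ns i + c)"
    using block_offset_less assms by (simp add: sum.delta)
  finally show ?thesis .
qed

text \<open>Written as a matrix product, taking a row block has an adjoint, namely left
  multiplication by \<open>E_col\<close>, which is the form in which it enters
  \<open>d_Y\<close>.\<close>

lemma row_block_eq:
  assumes M: "M \<in> carrier_mat n q" and i: "i < m"
  shows "row_block ns i M = (E_col n ns i)\<^sup>T * M"
proof (rule eq_matI)
  fix r c assume "r < dim_row ((E_col n ns i)\<^sup>T * M)" "c < dim_col ((E_col n ns i)\<^sup>T * M)"
  then have rc: "r < ns i" "c < q"
    using M E_col_carrier[of i] by (auto simp del: E_col_carrier)
  have "((E_col n ns i)\<^sup>T * M) $$ (r, c) = (M\<^sup>T * E_col n ns i)\<^sup>T $$ (r, c)"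
    using transpose_mult[of "M\<^sup>T" q n "E_col n ns i" "ns i"] M by simp
  also have "\<dots> = (M\<^sup>T * E_col n ns i) $$ (c, r)"
    using M rc E_col_carrier[of i] by (auto simp del: E_col_carrier)
  also have "\<dots> = M\<^sup>T $$ (c, block_offset ns i + r)"
    using M i rc by (intro index_mult_E_col) auto
  finally show "row_block ns i M $$ (r, c) = ((E_col n ns i)\<^sup>T * M) $$ (r, c)"
    using M i rc block_offset_less[of i r] by (auto simp: row_block_def)
qed (use M E_col_carrier[of i] in \<open>auto simp: row_block_def simp del: E_col_carrier\<close>)

lemma row_residual_index:
  assumes "X \<in> carrier_mat n n" "Y \<in> carrier_mat n n" "i < m" "r < ns i" "c < n"
  shows "row_residual ns A i X Y $$ (r, c)
    = Y $$ (block_offset ns i + r, c) - (\<Sum>l<n. A $$ (block_offset ns i + r, l) * X $$ (l, c))"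
proof -
  have "(row_block ns i A * X) $$ (r, c) = (\<Sum>l<n. row_block ns i A $$ (r, l) * X $$ (l, c))"
    using assms A_carrier by (intro index_mult_mat_sum) auto
  then show ?thesis
    using assms A_carrier by (simp add: row_residual_def row_block_def del: index_mult_mat(1))
qed

lemma col_residual_index:
  assumes "X \<in> carrier_mat n n" "Y \<in> carrier_mat n n" "i < m" "r < n" "c < ns i"
  shows "col_residual n ns A Q i X Y $$ (r, c)
    = (\<Sum>l<n. Y $$ (r, l) * A $$ (block_offset ns i + c, l))
      - X $$ (r, block_offset ns i + c) + Q $$ (r, block_offset ns i + c)"
proof -
  have "(Y * (row_block ns i A)\<^sup>T) $$ (r, c) = (\<Sum>l<n. Y $$ (r, l) * (row_block ns i A)\<^sup>T $$ (l, c))"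
    using assms A_carrier by (intro index_mult_mat_sum) auto
  also have "\<dots> = (\<Sum>l<n. Y $$ (r, l) * A $$ (block_offset ns i + c, l))"
    using assms A_carrier by (simp add: row_block_def)
  finally show ?thesis
    using assms Q_carrier E_col_carrier[of i] index_mult_E_col[of X n i r c]
    by (auto simp: col_residual_def col_block_def simp del: index_mult_mat(1) E_col_carrier)
qed

text \<open>These are the pairs at which both norms in every local cost vanish.\<close>

definition solves :: "real mat \<Rightarrow> real mat \<Rightarrow> bool" where
  "solves X Y \<longleftrightarrow> X \<in> carrier_mat n n \<and> Y \<in> carrier_mat n n \<and>
    (\<forall>i<m. row_residual ns A i X Y = 0\<^sub>m (ns i) n \<and> col_residual n ns A Q i X Y = 0\<^sub>m n (ns i))"

text \<open>The choice \<open>Y = A * X\<close> annihilates the row residuals, and each column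
  residual then becomes a column block of the Lyapunov equation.\<close>

lemma solves_of_lyapunov:
  assumes X: "X \<in> carrier_mat n n" and eq: "A * X * A\<^sup>T - X + Q = 0\<^sub>m n n"
  shows "solves X (A * X)"
  unfolding solves_def
proof (intro conjI allI impI)
  show AX: "A * X \<in> carrier_mat n n" using A_carrier X by simp
  fix i assume i: "i < m"
  show "row_residual ns A i X (A * X) = 0\<^sub>m (ns i) n"
  proof (rule eq_matI)
    fix r c assume "r < dim_row (0\<^sub>m (ns i) n)" "c < dim_col (0\<^sub>m (ns i) n)"
    then have "r < ns i" "c < n" by auto
    with i X AX A_carrier block_offset_less[of i r]
    show "row_residual ns A i X (A * X) $$ (r, c) = 0\<^sub>m (ns i) n $$ (r, c)"
      by (simp add: row_residual_index index_mult_mat_sum[of A n n X n] del: index_mult_mat(1))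
  qed (use row_residual_carrier[OF X AX, of i] in auto)
  show "col_residual n ns A Q i X (A * X) = 0\<^sub>m n (ns i)"
  proof (rule eq_matI)
    fix r c assume "r < dim_row (0\<^sub>m n (ns i))" "c < dim_col (0\<^sub>m n (ns i))"
    then have rc: "r < n" "c < ns i" by auto
    have c: "block_offset ns i + c < n" using block_offset_less[OF i rc(2)] .
    have "(A * X * A\<^sup>T - X + Q) $$ (r, block_offset ns i + c) = 0"
      using eq rc c by (simp del: assoc_mult_mat)
    with i X AX A_carrier Q_carrier rc c
    show "col_residual n ns A Q i X (A * X) $$ (r, c) = 0\<^sub>m n (ns i) $$ (r, c)"
      by (simp add: col_residual_index index_mult_mat_sum[of "A * X" n n "A\<^sup>T" n]
        del: index_mult_mat(1) assoc_mult_mat)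
  qed (use col_residual_carrier[OF X AX, of i] in auto)
qed (use X in auto)

text \<open>The residuals are affine and vanish at the solution, so they are linear images of the
  error; \<open>d_X\<close> and \<open>d_Y\<close> apply the adjoint of that linear map. Moving the
  adjoint across gives an exact identity, whose right side is twice the local cost.\<close>

lemma gradient_inner:
  assumes sol: "solves Xs Ys" and X: "X \<in> carrier_mat n n" and Y: "Y \<in> carrier_mat n n" and i: "i < m"
  shows "frob_inner (Y - Ys) (d_Y n ns A Q i X Y) + frob_inner (X - Xs) (d_X n ns A Q i X Y)
    = (frob_norm (row_residual ns A i X Y))\<^sup>2 + (frob_norm (col_residual n ns A Q i X Y))\<^sup>2"
proof -
  define Ar E T1 T2 where "Ar = row_block ns i A" and "E = E_col n ns i"
    and "T1 = row_residual ns A i X Y" and "T2 = col_residual n ns A Q i X Y"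
  have Xs: "Xs \<in> carrier_mat n n" and Ys: "Ys \<in> carrier_mat n n"
    and sol1: "row_residual ns A i Xs Ys = 0\<^sub>m (ns i) n"
    and sol2: "col_residual n ns A Q i Xs Ys = 0\<^sub>m n (ns i)"
    using sol i by (auto simp: solves_def)
  have carr: "Ar \<in> carrier_mat (ns i) n" "E \<in> carrier_mat n (ns i)"
      "T1 \<in> carrier_mat (ns i) n" "T2 \<in> carrier_mat n (ns i)"
      "X - Xs \<in> carrier_mat n n" "Y - Ys \<in> carrier_mat n n"
    using A_carrier X Y Xs Ys by (auto simp: Ar_def E_def T1_def T2_def)
  have T1: "T1 = E\<^sup>T * (Y - Ys) - Ar * (X - Xs)"
  proof -
    have "T1 = T1 - row_residual ns A i Xs Ys"
      using carr sol1 by (simp add: minus_zero_mat)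
    also have "\<dots> = E\<^sup>T * Y - Ar * X - (E\<^sup>T * Ys - Ar * Xs)"
      using X Y Xs Ys i by (simp add: T1_def row_residual_def row_block_eq[of _ n] Ar_def E_def)
    also have "\<dots> = E\<^sup>T * (Y - Ys) - Ar * (X - Xs)"
      using carr(1,2) X Y Xs Ys
      by (subst minus_minus_swap_mat[of _ "ns i" n])
        (simp_all add: mult_minus_distrib_mat[of _ "ns i" n _ n])
    finally show ?thesis .
  qed
  have T2: "T2 = (Y - Ys) * Ar\<^sup>T - (X - Xs) * E"
  proof -
    have "T2 = T2 - col_residual n ns A Q i Xs Ys"
      using carr sol2 by (simp add: minus_zero_mat)
    \<comment> \<open>The constant block of \<open>Q\<close> occurs in both residuals and
      cancels.\<close>
    also have "\<dots> = (Y * Ar\<^sup>T - Ys * Ar\<^sup>T) - (X * E - Xs * E)"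
      unfolding T2_def col_residual_def Ar_def[symmetric] E_def[symmetric]
      using carr(1,2) X Y Xs Ys
      by (intro minus_minus_add_swap_mat[of _ n "ns i"]) (auto intro: col_block_carrier[OF Q_carrier] simp del: col_block_carrier)
    also have "\<dots> = (Y - Ys) * Ar\<^sup>T - (X - Xs) * E"
      using carr(1,2) X Y Xs Ys
      by (simp add: minus_mult_distrib_mat[of _ n n _ _ "ns i"])
    finally show ?thesis .
  qed
  have prods: "Ar\<^sup>T * T1 \<in> carrier_mat n n" "T2 * E\<^sup>T \<in> carrier_mat n n" "E * T1 \<in> carrier_mat n n"
      "T2 * Ar \<in> carrier_mat n n" "E\<^sup>T * (Y - Ys) \<in> carrier_mat (ns i) n"
      "Ar * (X - Xs) \<in> carrier_mat (ns i) n" "(Y - Ys) * Ar\<^sup>T \<in> carrier_mat n (ns i)"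
      "(X - Xs) * E \<in> carrier_mat n (ns i)"
    using carr by auto
  have "frob_inner (Y - Ys) (d_Y n ns A Q i X Y) + frob_inner (X - Xs) (d_X n ns A Q i X Y)
      = (frob_inner (Y - Ys) (E * T1) + frob_inner (Y - Ys) (T2 * Ar))
        + (- frob_inner (X - Xs) (Ar\<^sup>T * T1) - frob_inner (X - Xs) (T2 * E\<^sup>T))"
    unfolding d_X_def d_Y_def Ar_def[symmetric] E_def[symmetric] T1_def[symmetric] T2_def[symmetric]
    using carr prods
    by (simp add: frob_inner_add_right[of _ n n] frob_inner_minus_right[of _ n n]
        frob_inner_uminus_right[of _ n n])
  also have "frob_inner (Y - Ys) (E * T1) = frob_inner (E\<^sup>T * (Y - Ys)) T1"
    using frob_inner_mult_left[of "E\<^sup>T" "ns i" n "Y - Ys" n T1] carr by simp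
  also have "frob_inner (Y - Ys) (T2 * Ar) = frob_inner ((Y - Ys) * Ar\<^sup>T) T2"
    using frob_inner_mult_right[of "Y - Ys" n n "Ar\<^sup>T" "ns i" T2] carr by simp
  also have "frob_inner (X - Xs) (Ar\<^sup>T * T1) = frob_inner (Ar * (X - Xs)) T1"
    using frob_inner_mult_left[of Ar "ns i" n "X - Xs" n T1] carr by simp
  also have "frob_inner (X - Xs) (T2 * E\<^sup>T) = frob_inner ((X - Xs) * E) T2"
    using frob_inner_mult_right[of "X - Xs" n n E "ns i" T2] carr by simp
  finally have "frob_inner (Y - Ys) (d_Y n ns A Q i X Y) + frob_inner (X - Xs) (d_X n ns A Q i X Y)
      = (frob_inner (E\<^sup>T * (Y - Ys)) T1 - frob_inner (Ar * (X - Xs)) T1)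
        + (frob_inner ((Y - Ys) * Ar\<^sup>T) T2 - frob_inner ((X - Xs) * E) T2)"
    by simp
  also have "\<dots> = frob_inner T1 T1 + frob_inner T2 T2"
    using frob_inner_minus_left[OF prods(5,6), of T1] frob_inner_minus_left[OF prods(7,8), of T2] T1 T2
    by simp
  finally show ?thesis
    by (simp add: frob_norm_square T1_def T2_def)
qed

text \<open>Affine residuals commute with averaging, so convexity reduces to Jensen's inequality for
  the square of each residual entry.\<close>

lemma local_cost_average_le:
  assumes XY: "\<And>l. X l \<in> carrier_mat n n" "\<And>l. Y l \<in> carrier_mat n n" and i: "i < m"
    and I: "finite I" "I \<noteq> {}"
    and Xa: "Xa = (1 / real (card I)) \<cdot>\<^sub>m mat_sum n n X I" and Ya: "Ya = (1 / real (card I)) \<cdot>\<^sub>m mat_sum n n Y I"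
  shows "local_cost n ns A Q i Xa Ya \<le> (\<Sum>l\<in>I. local_cost n ns A Q i (X l) (Y l)) / real (card I)"
proof -
  define w where "w = 1 / real (card I)"
  have w: "0 \<le> w" "(\<Sum>l\<in>I. w) = 1" using I by (auto simp: w_def)
  have carr: "Xa \<in> carrier_mat n n" "Ya \<in> carrier_mat n n"
    by (auto simp: Xa Ya mat_sum_def)
  have avg: "Xa $$ (r, c) = (\<Sum>l\<in>I. w * X l $$ (r, c))" "Ya $$ (r, c) = (\<Sum>l\<in>I. w * Y l $$ (r, c))"
    if "r < n" "c < n" for r c
    using that by (simp_all add: Xa Ya mat_sum_def w_def sum_divide_distrib)
  have jensen: "frob_inner M M \<le> (\<Sum>l\<in>I. w * frob_inner (N l) (N l))"
    if M: "M \<in> carrier_mat p q" "\<And>l. N l \<in> carrier_mat p q"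
      and eq: "\<And>r c. r < p \<Longrightarrow> c < q \<Longrightarrow> M $$ (r, c) = (\<Sum>l\<in>I. w * N l $$ (r, c))" for M N p q
  proof -
    have dims: "dim_row M = p" "dim_col M = q" "\<And>l. dim_row (N l) = p" "\<And>l. dim_col (N l) = q"
      using M by auto
    have "frob_inner M M = (\<Sum>r<p. \<Sum>c<q. (\<Sum>l\<in>I. w * N l $$ (r, c))\<^sup>2)"
      by (simp add: frob_inner_def dims eq power2_eq_square)
    also have "\<dots> \<le> (\<Sum>r<p. \<Sum>c<q. \<Sum>l\<in>I. w * (N l $$ (r, c))\<^sup>2)"
      by (intro sum_mono weighted_square_sum_le w)
    also have "\<dots> = (\<Sum>r<p. \<Sum>l\<in>I. \<Sum>c<q. w * (N l $$ (r, c))\<^sup>2)"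
      by (intro sum.cong refl sum.swap)
    also have "\<dots> = (\<Sum>l\<in>I. \<Sum>r<p. \<Sum>c<q. w * (N l $$ (r, c))\<^sup>2)"
      by (rule sum.swap)
    also have "\<dots> = (\<Sum>l\<in>I. w * frob_inner (N l) (N l))"
      by (simp add: frob_inner_def dims power2_eq_square sum_distrib_left)
    finally show ?thesis .
  qed
  have row: "row_residual ns A i Xa Ya $$ (r, c) = (\<Sum>l\<in>I. w * row_residual ns A i (X l) (Y l) $$ (r, c))"
    if rc: "r < ns i" "c < n" for r c
  proof -
    have "(\<Sum>l<n. A $$ (block_offset ns i + r, l) * Xa $$ (l, c))
        = (\<Sum>l<n. \<Sum>t\<in>I. w * (A $$ (block_offset ns i + r, l) * X t $$ (l, c)))"
      using rc by (simp add: avg sum_distrib_left mult.left_commute mult.assoc)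
    also have "\<dots> = (\<Sum>t\<in>I. \<Sum>l<n. w * (A $$ (block_offset ns i + r, l) * X t $$ (l, c)))"
      by (rule sum.swap)
    finally show ?thesis
      using rc block_offset_less[OF i rc(1)]
      by (simp add: row_residual_index[OF carr i] row_residual_index[OF XY i] avg sum_subtractf
          right_diff_distrib sum_distrib_left)
  qed
  have col: "col_residual n ns A Q i Xa Ya $$ (r, c)
      = (\<Sum>l\<in>I. w * col_residual n ns A Q i (X l) (Y l) $$ (r, c))"
    if rc: "r < n" "c < ns i" for r c
  proof -
    have "(\<Sum>l<n. Ya $$ (r, l) * A $$ (block_offset ns i + c, l))
        = (\<Sum>l<n. \<Sum>t\<in>I. w * (Y t $$ (r, l) * A $$ (block_offset ns i + c, l)))"
      using rc by (simp add: avg sum_distrib_left sum_distrib_right mult.left_commute mult.assoc)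
    also have "\<dots> = (\<Sum>t\<in>I. \<Sum>l<n. w * (Y t $$ (r, l) * A $$ (block_offset ns i + c, l)))"
      by (rule sum.swap)
    finally have Ya_A: "(\<Sum>l<n. Ya $$ (r, l) * A $$ (block_offset ns i + c, l))
        = (\<Sum>t\<in>I. \<Sum>l<n. w * (Y t $$ (r, l) * A $$ (block_offset ns i + c, l)))" .
    \<comment> \<open>The constant term survives averaging because the weights sum to 1.\<close>
    have "Q $$ (r, block_offset ns i + c) = (\<Sum>t\<in>I. w * Q $$ (r, block_offset ns i + c))"
      using w(2) by (simp flip: sum_distrib_right)
    with Ya_A show ?thesis
      using rc block_offset_less[OF i rc(2)]
      by (simp add: col_residual_index[OF carr i] col_residual_index[OF XY i] avg sum_subtractf
          sum.distrib right_diff_distrib distrib_left sum_distrib_left)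
  qed
  have "local_cost n ns A Q i Xa Ya
      \<le> 1/2 * (\<Sum>l\<in>I. w * frob_inner (row_residual ns A i (X l) (Y l)) (row_residual ns A i (X l) (Y l)))
      + 1/2 * (\<Sum>l\<in>I. w * frob_inner (col_residual n ns A Q i (X l) (Y l)) (col_residual n ns A Q i (X l) (Y l)))"
    unfolding local_cost_def frob_norm_square
    using jensen[OF row_residual_carrier[OF carr] row_residual_carrier[OF XY] row]
      jensen[OF col_residual_carrier[OF carr] col_residual_carrier[OF XY] col]
    by (intro add_mono mult_left_mono) auto
  also have "\<dots> = w * (\<Sum>l\<in>I. local_cost n ns A Q i (X l) (Y l))"
    by (simp add: local_cost_def frob_norm_square sum.distrib distrib_left sum_distrib_left
        mult.left_commute)
  finally show ?thesis by (simp add: w_def)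
qed

end

section \<open>Convergence of the distributed algorithm\<close>

lemma index_append_rows:
  assumes "Y \<in> carrier_mat p q" "X \<in> carrier_mat p' q" "r < p + p'" "c < q"
  shows "(Y @\<^sub>r X) $$ (r, c) = (if r < p then Y $$ (r, c) else X $$ (r - p, c))"
  using assms by (auto simp: append_rows_def)

lemma Y_part_append_rows:
  assumes "Y \<in> carrier_mat n n" "X \<in> carrier_mat n n"
  shows "Y_part n (Y @\<^sub>r X) = Y"
  using assms carrier_matD(2)[OF carrier_append_rows[OF assms]]
  by (intro eq_matI) (auto simp: Y_part_def vblock_def index_append_rows[OF assms])

lemma X_part_append_rows:
  assumes "Y \<in> carrier_mat n n" "X \<in> carrier_mat n n"
  shows "X_part n (Y @\<^sub>r X) = X"
  using assms carrier_matD(2)[OF carrier_append_rows[OF assms]]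
  by (intro eq_matI) (auto simp: X_part_def vblock_def index_append_rows[OF assms])

lemma mult_add_less_mult:
  fixes i p m r :: nat
  assumes "i < m" "r < p"
  shows "i * p + r < m * p"
proof -
  have "i * p + r < Suc i * p" using assms(2) by simp
  also have "\<dots> \<le> m * p" using assms(1) by (intro mult_le_mono1) simp
  finally show ?thesis .
qed

lemma vblock_vstack:
  assumes "i < m" "M i \<in> carrier_mat p q"
  shows "vblock p i (vstack m p q M) = M i"
  using assms mult_add_less_mult[OF assms(1)]
  by (intro eq_matI) (auto simp: vblock_def vstack_def)

context block_partition
begin

lemma local_cost_eq_0: "solves X Y \<Longrightarrow> i < m \<Longrightarrow> local_cost n ns A Q i X Y = 0"
  by (simp add: solves_def local_cost_def frob_norm_def)

text \<open>The total cost is nonnegative everywhere and 0 at this stack, so no comparison with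
  particular feasible points is required.\<close>

lemma optimal_solution_of_solves:
  assumes sol: "solves X Y"
  shows "optimal_solution m n ns A Q (vstack m (2 * n) n (\<lambda>_. Y @\<^sub>r X))"
proof -
  have XY: "X \<in> carrier_mat n n" "Y \<in> carrier_mat n n" using sol by (auto simp: solves_def)
  have YX: "Y @\<^sub>r X \<in> carrier_mat (2 * n) n"
    using carrier_append_rows[OF XY(2,1)] by (simp add: mult_2)
  have "total_cost m n ns A Q (vstack m (2 * n) n (\<lambda>_. Y @\<^sub>r X)) = 0"
    using YX XY sol
    by (simp add: total_cost_def vblock_vstack local_cost_Z_def Y_part_append_rows X_part_append_rows
        local_cost_eq_0)
  moreover have "0 \<le> total_cost m n ns A Q Z" for Z
    by (simp add: total_cost_def local_cost_Z_def local_cost_def sum_nonneg)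
  ultimately show ?thesis
    using YX XY by (auto simp: optimal_solution_def feasible_def vblock_vstack)
      (simp_all add: vstack_def)
qed

end

text \<open>Connectedness is defined through the symmetric closure of the union graph. Each
  \<open>G t\<close> is itself symmetric, so every step of a walk in the closure is already an edge
  of the union.\<close>

lemma uniformly_connected_rtrancl:
  assumes graphs: "\<forall>k. pair_graph (G k) \<and> pverts (G k) = {..<m}"
    and conn: "uniformly_connected m G"
  obtains B where "\<And>k i j. i < m \<Longrightarrow> j < m \<Longrightarrow>
    (i, j) \<in> {(i, j). i < m \<and> j < m \<and> (\<exists>t\<in>{k..<k + B}. (i, j) \<in> parcs (G t))}\<^sup>*"
proof -
  obtain B where B: "\<And>k. Digraph_Component.connected
      (with_proj \<lparr>pverts = {..<m}, parcs = (\<Union>t\<in>{k..<k + B}. parcs (G t))\<rparr>)"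
    using conn by (auto simp: uniformly_connected_def)
  show ?thesis
  proof (rule that[of B])
    fix k i j assume ij: "i < m" "j < m"
    let ?H = "with_proj \<lparr>pverts = {..<m}, parcs = (\<Union>t\<in>{k..<k + B}. parcs (G t))\<rparr>"
    let ?E = "{(i, j). i < m \<and> j < m \<and> (\<exists>t\<in>{k..<k + B}. (i, j) \<in> parcs (G t))}"
    have sym: "(j, i) \<in> parcs (G t)" if "(i, j) \<in> parcs (G t)" for t i j
    proof -
      interpret pair_graph "G t" using graphs by blast
      show ?thesis using that arcs_symmetric by blast
    qed
    have "(i, j) \<in> rtrancl_on {..<m} (parcs (mk_symmetric ?H))"
      using B[of k] ij by (auto simp: connected_def strongly_connected_def reachable_def)
    then show "(i, j) \<in> ?E\<^sup>*"
    proof (induction rule: rtrancl_on_induct)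
      case (step y z)
      then obtain t where "t \<in> {k..<k + B}" "(y, z) \<in> parcs (G t) \<or> (z, y) \<in> parcs (G t)"
        by (auto simp: parcs_mk_symmetric)
      with step.hyps have "(y, z) \<in> ?E" using sym by blast
      with step.IH show ?case by (rule rtrancl_into_rtrancl)
    qed simp
  qed
qed

theorem theorem1:
  fixes m n :: nat
    and ns :: "nat \<Rightarrow> nat"
    and A Q :: "real mat"
    and G :: "nat \<Rightarrow> nat pair_pre_digraph"
    and a :: "nat \<Rightarrow> real mat"
    and \<alpha> \<xi> :: "nat \<Rightarrow> real"
    and X Y :: "nat \<Rightarrow> nat \<Rightarrow> real mat"
  assumes m_pos: "1 \<le> m"
    and ns_pos: "\<forall>i<m. 1 \<le> ns i"
    and ns_sum: "(\<Sum>i<m. ns i) = n"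
    and A: "A \<in> carrier_mat n n"
    and Q: "Q \<in> carrier_mat n n" "Q\<^sup>T = Q"
    and solvable: "\<exists>X0\<in>carrier_mat n n. A * X0 * A\<^sup>T - X0 + Q = 0\<^sub>m n n"
    and graphs: "\<forall>k. pair_graph (G k) \<and> pverts (G k) = {..<m}"
    and adjacency: "\<forall>k. adjacency_matrix m (G k) (a k)"
    and stochastic: "\<forall>k. doubly_stochastic m (a k)"
    and step_sizes: "\<forall>i<m. 0 < \<alpha> i \<and> \<alpha> i < min 1 (1 / \<xi> i)"
    and xi: "\<forall>i<m. \<forall>T1\<in>carrier_mat (ns i) n. \<forall>T2\<in>carrier_mat n (ns i).
        (frob_norm (- ((row_block ns i A)\<^sup>T * T1) - T2 * (E_col n ns i)\<^sup>T))\<^sup>2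
        + (frob_norm (E_col n ns i * T1 + T2 * row_block ns i A))\<^sup>2
        \<le> \<xi> i * (frob_norm T1)\<^sup>2 + \<xi> i * (frob_norm T2)\<^sup>2"
    and connectivity: "uniformly_connected m G"
    and weights: "\<exists>\<eta>. 0 < \<eta> \<and> \<eta> < 1 \<and> (\<forall>k. \<forall>i<m.
        \<eta> \<le> mixing_weight m (G k) (a k) \<alpha> i i \<and>
        (\<forall>j<m. j \<noteq> i \<longrightarrow>
          (if j \<in> nbrs (G k) i then \<eta> \<le> mixing_weight m (G k) (a k) \<alpha> i j
           else mixing_weight m (G k) (a k) \<alpha> i j = 0)))"
    and algorithm: "generated_by_algorithm m n ns A Q G a \<alpha> X Y"
  shows "(\<exists>Zstar. optimal_solution m n ns A Q Zstar \<and>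
            (\<lambda>k. frob_norm (stacked_state m n X Y k - Zstar)) \<longlonglongrightarrow> 0)
       \<and> (\<lambda>k. \<Sum>i<m. (1 - \<alpha> i * \<xi> i) * local_cost_Z n ns A Q i (averaged_state n X Y i k))
            \<in> O(\<lambda>k. 1 / real k)"
proof -
  interpret block_partition m n ns A Q
    using ns_sum A Q by unfold_locales
  have carr: "X i k \<in> carrier_mat n n" "Y i k \<in> carrier_mat n n" if "i < m" for i k
    using algorithm that
    by (cases k; auto simp: generated_by_algorithm_def consensus_term_def mat_sum_def)+
  have a_eq_0: "a k $$ (i, j) = 0" if "i < m" "j < m" "j \<notin> nbrs (G k) i" for k i j
    using adjacency that by (force simp: adjacency_matrix_def nbrs_def)
  have a_sym: "a k $$ (i, j) = a k $$ (j, i)" if "i < m" "j < m" for k i j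
    using adjacency that by (metis adjacency_matrix_def carrier_matD index_transpose_mat(1))
  have nbrs: "nbrs (G k) i \<subseteq> {..<m}" for k i
  proof -
    interpret pair_graph "G k" using graphs by blast
    show ?thesis using graphs by (auto simp: nbrs_def dest: in_arcsD2)
  qed
  have consensus: "consensus_term n (G k) (a k) M i $$ (r, c)
      = (\<Sum>j<m. a k $$ (i, j) * (M i $$ (r, c) - M j $$ (r, c)))"
    if "i < m" "r < n" "c < n" "\<And>j. j < m \<Longrightarrow> M j \<in> carrier_mat n n" for k i r c M
  proof -
    have "consensus_term n (G k) (a k) M i $$ (r, c)
        = (\<Sum>j\<in>nbrs (G k) i. a k $$ (i, j) * (M i $$ (r, c) - M j $$ (r, c)))"
      using that nbrs[of k i] by (force simp: consensus_term_def mat_sum_def intro!: sum.cong)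
    \<comment> \<open>Weights vanish off the edges, so the sum over neighbours extends to all
      agents.\<close>
    also have "\<dots> = (\<Sum>j<m. a k $$ (i, j) * (M i $$ (r, c) - M j $$ (r, c)))"
      using nbrs that by (intro sum.mono_neutral_left) (auto simp: a_eq_0)
    finally show ?thesis .
  qed
  obtain \<eta> where \<eta>: "0 < \<eta>" and w: "\<And>k i j. i < m \<Longrightarrow> j < m \<Longrightarrow> j \<noteq> i \<Longrightarrow> j \<in> nbrs (G k) i \<Longrightarrow>
      \<eta> \<le> mixing_weight m (G k) (a k) \<alpha> i j"
    using weights by (metis (no_types, lifting))
  have step: "0 < \<alpha> i" "\<alpha> i < 1" "\<alpha> i * \<xi> i < 1" if "i < m" for i
  proof -
    show "0 < \<alpha> i" "\<alpha> i < 1" using step_sizes that by auto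
    have "\<alpha> i < 1 / \<xi> i" using step_sizes that by simp
    \<comment> \<open>A positive step below \<open>1 / \<xi> i\<close> forces \<open>\<xi> i\<close>
      to be positive, also under the convention \<open>1 / 0 = 0\<close>; only then can the bound be
      multiplied out.\<close>
    with \<open>0 < \<alpha> i\<close> have "0 < \<xi> i" by (metis less_trans zero_less_divide_1_iff)
    with \<open>\<alpha> i < 1 / \<xi> i\<close> show "\<alpha> i * \<xi> i < 1" by (simp add: field_simps)
  qed
  have a_lower: "\<eta> \<le> a k $$ (i, j)" if ij: "i < m" "j < m" and pos: "0 < a k $$ (i, j)" for k i j
  proof -
    have "j \<noteq> i" using adjacency that unfolding adjacency_matrix_def by (metis less_irrefl)
    moreover have "j \<in> nbrs (G k) i" using a_eq_0[OF ij] pos by force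
    \<comment> \<open>The hypothesis bounds the mixing weight; as \<open>\<alpha> i / 2\<close> is
      below 1, the same \<open>\<eta>\<close> bounds the adjacency entry.\<close>
    ultimately have "\<eta> \<le> \<alpha> i / 2 * a k $$ (i, j)"
      using w[OF ij] ij by (auto simp: mixing_weight_def laplacian_def)
    also have "\<dots> \<le> 1 * a k $$ (i, j)"
      using step(2)[OF ij(1)] pos by (intro mult_right_mono) auto
    finally show ?thesis by simp
  qed
  obtain B where B: "\<And>k i j. i < m \<Longrightarrow> j < m \<Longrightarrow>
      (i, j) \<in> {(i, j). i < m \<and> j < m \<and> (\<exists>t\<in>{k..<k + B}. (i, j) \<in> parcs (G t))}\<^sup>*"
    by (rule uniformly_connected_rtrancl[OF graphs connectivity]) blast
  have edges: "{(i, j). i < m \<and> j < m \<and> (\<exists>t\<in>{k..<k + B}. (i, j) \<in> parcs (G t))}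
      = {(i, j). i < m \<and> j < m \<and> (\<exists>t\<in>{k..<k + B}. 0 < a t $$ (i, j))}" for k
    using adjacency by (auto simp: adjacency_matrix_def)

  \<comment> \<open>A pair of matrices \<open>(Y, X)\<close> is encoded by its entries, indexed by \<open>Inl (r, c)\<close> and
    \<open>Inr (r, c)\<close> respectively.\<close>
  define S where "S = ({..<n} \<times> {..<n}) <+> ({..<n} \<times> {..<n})"
  define z where "z k i = case_sum (($$) (Y i k)) (($$) (X i k))" for k i
  define g where "g k i = case_sum (($$) (d_Y n ns A Q i (X i k) (Y i k)))
      (($$) (d_X n ns A Q i (X i k) (Y i k)))" for k i
  \<comment> \<open>The factor 2 cancels the halves in the cost, making \<open>R\<close> the sum of
    squared residual norms that \<open>gradient_inner\<close> and the bound by \<open>\<xi>\<close>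
    speak of.\<close>
  define R where "R k i = 2 * local_cost n ns A Q i (X i k) (Y i k)" for k i
  define mX where "mX p = mat n n (p \<circ> Inr)" for p :: "nat \<times> nat + nat \<times> nat \<Rightarrow> real"
  define mY where "mY p = mat n n (p \<circ> Inl)" for p :: "nat \<times> nat + nat \<times> nat \<Rightarrow> real"
  define P where "P = {p. solves (mX p) (mY p)}"
  have sum_S: "(\<Sum>s\<in>S. h s) = (\<Sum>r<n. \<Sum>c<n. h (Inl (r, c))) + (\<Sum>r<n. \<Sum>c<n. h (Inr (r, c)))"
    for h :: "_ \<Rightarrow> real"
    unfolding S_def by (simp add: sum.Plus sum.cartesian_product)
  have R_eq: "R k i = frob_inner (row_residual ns A i (X i k) (Y i k)) (row_residual ns A i (X i k) (Y i k))
      + frob_inner (col_residual n ns A Q i (X i k) (Y i k)) (col_residual n ns A Q i (X i k) (Y i k))" for k i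
    by (simp add: R_def local_cost_def frob_norm_square)

  interpret consensus_descent S m "\<lambda>k i j. a k $$ (i, j)" \<alpha> \<xi> z g R P \<eta> B
  proof
    show "finite S" by (simp add: S_def)
    show "0 < m" using m_pos by simp
    show "0 < \<eta>" by (rule \<eta>)
    fix i assume i: "i < m"
    show "0 < \<alpha> i" "\<alpha> i < 1" "\<alpha> i * \<xi> i < 1" using step[OF i] .
    show "(\<Sum>j<m. a k $$ (i, j)) = 1" for k using stochastic i by (auto simp: doubly_stochastic_def)
    show "0 \<le> R k i" for k by (simp add: R_eq frob_inner_nonneg)
    show "z (Suc k) i s = z k i s - \<alpha> i * g k i s
        - \<alpha> i / 2 * (\<Sum>j<m. a k $$ (i, j) * (z k i s - z k j s))" if s: "s \<in> S" for k s
    proof -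
      have X: "X i (Suc k) = X i k - \<alpha> i \<cdot>\<^sub>m d_X n ns A Q i (X i k) (Y i k)
            - (\<alpha> i / 2) \<cdot>\<^sub>m consensus_term n (G k) (a k) (\<lambda>j. X j k) i"
        and Y: "Y i (Suc k) = Y i k - \<alpha> i \<cdot>\<^sub>m d_Y n ns A Q i (X i k) (Y i k)
            - (\<alpha> i / 2) \<cdot>\<^sub>m consensus_term n (G k) (a k) (\<lambda>j. Y j k) i"
        using algorithm i by (auto simp: generated_by_algorithm_def)
      have dims: "d_X n ns A Q i (X i k) (Y i k) \<in> carrier_mat n n"
          "d_Y n ns A Q i (X i k) (Y i k) \<in> carrier_mat n n"
          "consensus_term n (G k) (a k) M i \<in> carrier_mat n n" for M
        using carr[OF i] by (auto simp: consensus_term_def mat_sum_def)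
      from s obtain r c where rc: "r < n" "c < n" and "s = Inl (r, c) \<or> s = Inr (r, c)"
        by (auto simp: S_def)
      then show ?thesis
        using rc carr carrier_matD[OF carr(1)[OF i, of k]] carrier_matD[OF carr(2)[OF i, of k]]
          carrier_matD[OF dims(1)] carrier_matD[OF dims(2)]
          carrier_matD[OF dims(3)[of "\<lambda>j. X j k"]] carrier_matD[OF dims(3)[of "\<lambda>j. Y j k"]]
          consensus[OF i rc, of "\<lambda>j. X j k" k] consensus[OF i rc, of "\<lambda>j. Y j k" k]
        by (auto simp: z_def g_def X Y)
    qed
    show "(\<Sum>s\<in>S. (z k i s - p s) * g k i s) = R k i" if p: "p \<in> P" for p k
    proof -
      have sol: "solves (mX p) (mY p)" using p by (simp add: P_def)
      have "(\<Sum>s\<in>S. (z k i s - p s) * g k i s)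
          = frob_inner (Y i k - mY p) (d_Y n ns A Q i (X i k) (Y i k))
            + frob_inner (X i k - mX p) (d_X n ns A Q i (X i k) (Y i k))"
        using carr[OF i, of k] by (simp add: sum_S frob_inner_def z_def g_def mX_def mY_def)
      also have "\<dots> = R k i"
        using gradient_inner[OF sol carr[OF i, of k] i] by (simp add: R_eq frob_norm_square)
      finally show ?thesis .
    qed
    show "(\<Sum>s\<in>S. (g k i s)\<^sup>2) \<le> \<xi> i * R k i" for k
    proof -
      have "(\<Sum>s\<in>S. (g k i s)\<^sup>2) = (frob_norm (d_X n ns A Q i (X i k) (Y i k)))\<^sup>2
          + (frob_norm (d_Y n ns A Q i (X i k) (Y i k)))\<^sup>2"
        using carrier_matD[OF d_X_carrier[OF carr[OF i, of k]], of i]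
          carrier_matD[OF d_Y_carrier[OF carr[OF i, of k]], of i]
        unfolding frob_norm_square by (simp add: sum_S frob_inner_def g_def power2_eq_square)
      also have "\<dots> \<le> \<xi> i * (frob_norm (row_residual ns A i (X i k) (Y i k)))\<^sup>2
          + \<xi> i * (frob_norm (col_residual n ns A Q i (X i k) (Y i k)))\<^sup>2"
        unfolding d_X_def d_Y_def
        using xi i row_residual_carrier[OF carr[OF i, of k]] col_residual_carrier[OF carr[OF i, of k]]
        by blast
      also have "\<dots> = \<xi> i * R k i"
        by (simp add: R_eq frob_norm_square distrib_left)
      finally show ?thesis .
    qed
    fix j assume j: "j < m"
    show "a k $$ (i, j) = a k $$ (j, i)" for k using a_sym[OF i j] .
    show "0 \<le> a k $$ (i, j)" for k using stochastic i j by (auto simp: doubly_stochastic_def)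
    show "\<eta> \<le> a k $$ (i, j)" if "0 < a k $$ (i, j)" for k using a_lower[OF i j that] .
    show "(i, j) \<in> {(i, j). i < m \<and> j < m \<and> (\<exists>t\<in>{k..<k + B}. 0 < a t $$ (i, j))}\<^sup>*" for k
      using B[OF i j, of k] unfolding edges .
  next
    fix r p assume r: "strict_mono (r :: nat \<Rightarrow> nat)"
      and lim: "\<And>i s. i < m \<Longrightarrow> s \<in> S \<Longrightarrow> (\<lambda>k. z (r k) i s) \<longlonglongrightarrow> p s"
      and R0: "\<And>i. i < m \<Longrightarrow> (\<lambda>k. R k i) \<longlonglongrightarrow> 0"
    have m_carr: "mX p \<in> carrier_mat n n" "mY p \<in> carrier_mat n n" by (auto simp: mX_def mY_def)
    have "row_residual ns A i (mX p) (mY p) = 0\<^sub>m (ns i) n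
        \<and> col_residual n ns A Q i (mX p) (mY p) = 0\<^sub>m n (ns i)" if i: "i < m" for i
    proof -
      have limX: "(\<lambda>k. X i (r k) $$ (u, v)) \<longlonglongrightarrow> mX p $$ (u, v)"
        and limY: "(\<lambda>k. Y i (r k) $$ (u, v)) \<longlonglongrightarrow> mY p $$ (u, v)" if "u < n" "v < n" for u v
        using lim[OF i, of "Inr (u, v)"] lim[OF i, of "Inl (u, v)"] that
        by (auto simp: S_def z_def mX_def mY_def)
      have Rr: "(\<lambda>k. R (r k) i) \<longlonglongrightarrow> 0"
        using LIMSEQ_subseq_LIMSEQ[OF R0[OF i] r] by (simp add: o_def)
      \<comment> \<open>Along the subsequence the entry tends to its value at the limit by
        continuity and to 0 because its square is at most \<open>R\<close>.\<close>
      have row: "row_residual ns A i (mX p) (mY p) $$ (u, v) = 0" if uv: "u < ns i" "v < n" for u v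
      proof (rule LIMSEQ_unique)
        show "(\<lambda>k. row_residual ns A i (X i (r k)) (Y i (r k)) $$ (u, v))
            \<longlonglongrightarrow> row_residual ns A i (mX p) (mY p) $$ (u, v)"
          unfolding row_residual_index[OF m_carr i uv] row_residual_index[OF carr[OF i] i uv]
          using uv block_offset_less[OF i uv(1)] by (intro tendsto_intros limX limY) auto
        show "(\<lambda>k. row_residual ns A i (X i (r k)) (Y i (r k)) $$ (u, v)) \<longlonglongrightarrow> 0"
        proof (rule tendsto_0_if_square_le[OF Rr])
          fix k
          show "(row_residual ns A i (X i (r k)) (Y i (r k)) $$ (u, v))\<^sup>2 \<le> R (r k) i"
            unfolding R_eq
            using square_le_frob_inner[of u "row_residual ns A i (X i (r k)) (Y i (r k))" v] uv
              carrier_matD[OF row_residual_carrier[OF carr[OF i, of "r k"], of i]]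
            by (simp add: frob_inner_nonneg add_increasing2)
        qed
      qed
      have col: "col_residual n ns A Q i (mX p) (mY p) $$ (u, v) = 0" if uv: "u < n" "v < ns i" for u v
      proof (rule LIMSEQ_unique)
        show "(\<lambda>k. col_residual n ns A Q i (X i (r k)) (Y i (r k)) $$ (u, v))
            \<longlonglongrightarrow> col_residual n ns A Q i (mX p) (mY p) $$ (u, v)"
          unfolding col_residual_index[OF m_carr i uv] col_residual_index[OF carr[OF i] i uv]
          using uv block_offset_less[OF i uv(2)] by (intro tendsto_intros limX limY) auto
        show "(\<lambda>k. col_residual n ns A Q i (X i (r k)) (Y i (r k)) $$ (u, v)) \<longlonglongrightarrow> 0"
        proof (rule tendsto_0_if_square_le[OF Rr])
          fix k
          show "(col_residual n ns A Q i (X i (r k)) (Y i (r k)) $$ (u, v))\<^sup>2 \<le> R (r k) i"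
            unfolding R_eq
            using square_le_frob_inner[of u "col_residual n ns A Q i (X i (r k)) (Y i (r k))" v] uv
              carrier_matD[OF col_residual_carrier[OF carr[OF i, of "r k"], of i]]
            by (simp add: frob_inner_nonneg add_increasing)
        qed
      qed
      show ?thesis
        using carrier_matD[OF row_residual_carrier[OF m_carr, of i]]
          carrier_matD[OF col_residual_carrier[OF m_carr, of i]]
        by (intro conjI eq_matI) (auto simp: row col)
    qed
    then show "p \<in> P" using m_carr by (simp add: P_def solves_def)
  next
    obtain X0 where X0: "X0 \<in> carrier_mat n n" "A * X0 * A\<^sup>T - X0 + Q = 0\<^sub>m n n"
      using solvable by blast
    let ?p = "case_sum (($$) (A * X0)) (($$) X0)"
    have "mX ?p = X0" "mY ?p = A * X0"
      using X0(1) A by (auto simp: mX_def mY_def intro!: eq_matI simp del: index_mult_mat(1))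
    with solves_of_lyapunov[OF X0] have "?p \<in> P" by (simp add: P_def)
    then show "P \<noteq> {}" by blast
  qed

  show ?thesis
  proof
    obtain p where p: "p \<in> P" and lim: "\<And>i s. i < m \<Longrightarrow> s \<in> S \<Longrightarrow> (\<lambda>k. z k i s) \<longlonglongrightarrow> p s"
      using converges_to_solution by blast
    have sol: "solves (mX p) (mY p)" using p by (simp add: P_def)
    have m_carr: "mY p \<in> carrier_mat n n" "mX p \<in> carrier_mat n n" by (auto simp: mX_def mY_def)
    let ?Z = "vstack m (2 * n) n (\<lambda>_. mY p @\<^sub>r mX p)"
    have entry: "(\<lambda>k. (stacked_state m n X Y k - ?Z) $$ (u, v)) \<longlonglongrightarrow> 0"
      if uv: "u < m * (2 * n)" "v < n" for u v
    proof -
      \<comment> \<open>Row \<open>u\<close> of the stack is row \<open>q\<close> of agent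
        \<open>i\<close>, lying in its \<open>Y\<close> part if \<open>q < n\<close> and in its
        \<open>X\<close> part otherwise.\<close>
      define i q where "i = u div (2 * n)" and "q = u mod (2 * n)"
      have i: "i < m" using uv by (simp add: i_def less_mult_imp_div_less)
      have q: "q < n + n" using uv by (simp add: q_def mult_2[symmetric])
      have q': "q - n < n" if "\<not> q < n" using q that by linarith
      have "(\<lambda>k. (Y i k @\<^sub>r X i k) $$ (q, v)) \<longlonglongrightarrow> (mY p @\<^sub>r mX p) $$ (q, v)"
        unfolding index_append_rows[OF m_carr q uv(2)] index_append_rows[OF carr(2,1)[OF i] q uv(2)]
        using lim[OF i, of "Inl (q, v)"] lim[OF i, of "Inr (q - n, v)"] q' uv(2)
        by (auto simp: S_def z_def mX_def mY_def)
      from LIM_zero[OF this] show ?thesis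
        using uv by (simp add: stacked_state_def vstack_def agent_state_def i_def q_def)
    qed
    have "(\<lambda>k. frob_norm (stacked_state m n X Y k - ?Z))
        \<longlonglongrightarrow> sqrt (\<Sum>u<m * (2 * n). \<Sum>v<n. 0\<^sup>2)"
      unfolding frob_norm_def
      by (simp only: index_minus_mat dim_row_mat dim_col_mat vstack_def)
        (intro tendsto_intros entry[unfolded vstack_def]; simp)
    then show "\<exists>Zstar. optimal_solution m n ns A Q Zstar \<and>
        (\<lambda>k. frob_norm (stacked_state m n X Y k - Zstar)) \<longlonglongrightarrow> 0"
      using optimal_solution_of_solves[OF sol] by auto
  next
    obtain C where C: "\<And>N. (\<Sum>k<N. \<Sum>i<m. (1 - \<alpha> i * \<xi> i) * R k i) \<le> C"
      using R_partial_sums_bounded by blast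
    let ?f = "\<lambda>k. \<Sum>i<m. (1 - \<alpha> i * \<xi> i) * local_cost_Z n ns A Q i (averaged_state n X Y i k)"
    \<comment> \<open>The constant is halved because \<open>C\<close> bounds sums of
      \<open>R\<close>, which is twice the cost.\<close>
    have "norm (?f k) \<le> C / 2 * norm (1 / real k)" if k: "1 \<le> k" for k
    proof -
      have cost: "local_cost_Z n ns A Q i (averaged_state n X Y i k) \<le> (\<Sum>l=1..k. R l i / 2) / real k"
        if i: "i < m" for i
      proof -
        have "X_part n (averaged_state n X Y i k) = (1 / real k) \<cdot>\<^sub>m mat_sum n n (X i) {1..k}"
          "Y_part n (averaged_state n X Y i k) = (1 / real k) \<cdot>\<^sub>m mat_sum n n (Y i) {1..k}"
          by (auto simp: X_part_def Y_part_def vblock_def averaged_state_def mat_sum_def agent_state_def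
              index_append_rows[OF carr(2,1)[OF i]] intro!: eq_matI)
        then show ?thesis
          using local_cost_average_le[of "X i" "Y i" i "{1..k}", OF carr[OF i] i] k
          by (simp add: local_cost_Z_def R_def)
      qed
      have "0 \<le> ?f k"
        using step(3) by (auto intro!: sum_nonneg mult_nonneg_nonneg
            simp: less_imp_le local_cost_Z_def local_cost_def)
      then have "norm (?f k) = ?f k" by simp
      also have "\<dots> \<le> (\<Sum>i<m. (1 - \<alpha> i * \<xi> i) * ((\<Sum>l=1..k. R l i / 2) / real k))"
        using step(3) by (intro sum_mono mult_left_mono cost) (auto simp: less_imp_le)
      also have "\<dots> = (\<Sum>i<m. \<Sum>l=1..k. (1 - \<alpha> i * \<xi> i) * R l i) / (2 * real k)"
        by (simp add: sum_distrib_left sum_divide_distrib)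
      also have "(\<Sum>i<m. \<Sum>l=1..k. (1 - \<alpha> i * \<xi> i) * R l i) = (\<Sum>l=1..k. \<Sum>i<m. (1 - \<alpha> i * \<xi> i) * R l i)"
        by (rule sum.swap)
      \<comment> \<open>The averages start at time 1 but the bounded partial sums at time 0; the
        added term is nonnegative.\<close>
      also have "\<dots> / (2 * real k) \<le> (\<Sum>l<Suc k. \<Sum>i<m. (1 - \<alpha> i * \<xi> i) * R l i) / (2 * real k)"
        by (intro divide_right_mono sum_mono2 sum_nonneg weighted_R_nonneg) auto
      also have "\<dots> \<le> C / (2 * real k)"
        by (intro divide_right_mono C) simp
      finally show ?thesis by simp
    qed
    then show "?f \<in> O(\<lambda>k. 1 / real k)"
      by (intro bigoI[of _ "C / 2"] eventually_sequentiallyI[of 1])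
  qed
qed

end
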